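(* For every $n\geq 1$ there exists a bijection $\Psi:\mathbf{I}_n(021)\to\mathfrak{S}_n(2413,4213)$ such that for every $e\in\mathbf{I}_n(021)$, with $\pi=\Psi(e)$, $$\big(\mathrm{DIST}(e),\mathrm{ASC}(e),\mathrm{ZERO}(e),\mathrm{EMA}(e),\mathrm{RMI}(e),\mathrm{EXPO}(e)\big)=\big(\mathrm{VID}(\pi),\mathrm{DES}(\pi),\mathrm{LMA}(\pi),\mathrm{LMI}(\pi),\mathrm{RMA}(\pi),\mathrm{RMI}(\pi)\big).$$
   Context: $\mathbf{I}_n=\{(e_1,\dots,e_n)\in\mathbb{Z}^n: 0\le e_i\le i-1\}$ is the set of inversion sequences of length $n$; $\mathfrak{S}_n$ is the set of permutations $\pi=\pi_1\cdots\pi_n$ of $[n]=\{1,\dots,n\}$. Both are regarded as words. A word $W=w_1\cdots w_n$ contains a pattern $P=p_1\cdots p_k$ if some subword $w_{i_1}\cdots w_{i_k}$ ($i_1<\dots<i_k$) is order isomorphic to $P$ (i.e. $w_{i_a}<w_{i_b}$ iff $p_a<p_b$ and $w_{i_a}=w_{i_b}$ iff $p_a=p_b$); otherwise $W$ avoids $P$. For a set $\mathcal W$ of words, $\mathcal W(P_1,\dots,P_r)$ is the set of words in $\mathcal W$ avoiding all $P_j$. Statistics on $\pi\in\mathfrak{S}_n$: $\mathrm{DES}(\pi)=\{i\in[n-1]:\pi_i>\pi_{i+1}\}$; $\mathrm{VID}(\pi)=\{i\in[n]:\pi_i<n \text{ and the value }\pi_i+1\text{ appears at a position to the left of } i\}$;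 $\mathrm{LMA}(\pi)=\{i:\pi_i>\pi_j \ \forall j<i\}$; $\mathrm{LMI}(\pi)=\{i:\pi_i<\pi_j\ \forall j<i\}$; $\mathrm{RMA}(\pi)=\{i:\pi_i>\pi_j\ \forall j>i\}$; $\mathrm{RMI}(\pi)=\{i:\pi_i<\pi_j\ \forall j>i\}$. Statistics on $e\in\mathbf{I}_n$: $\mathrm{ASC}(e)=\{i\in[n-1]:e_i<e_{i+1}\}$; $\mathrm{DIST}(e)=\{2\le i\le n: e_i\ne 0 \text{ and } e_i\neq e_j \ \forall j>i\}$; $\mathrm{ZERO}(e)=\{i:e_i=0\}$; $\mathrm{EMA}(e)=\{i:e_i=i-1\}$; $\mathrm{RMI}(e)=\{i: e_i<e_j\ \forall j>i\}$. Exposed positions: for $e\in\mathbf{I}_n(021)$ define $d_i=e_i$ if $e_i\ne0$ and $d_i=\max\{e_1,\dots,e_i\}$ if $e_i=0$. Let $\mathcal{C}(e)=\{i: e_i=0 \text{ and there exist } a<i<b \text{ with } e_a=e_b\neq 0\}$. Then $\mathrm{EXPO}(e)=\{i\in[n]: i\notin\mathcal C(e)\text{ and } i-d_i<j-d_j \text{ for all } j \text{ with } i<j\le n\}$. *)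

theory Defs
  imports Main
begin

text \<open>Words are lists of naturals; positions are 1-indexed: the i-th letter of w is w ! (i - 1).\<close>

definition letter :: "nat list \<Rightarrow> nat \<Rightarrow> nat" where
  "letter w i = w ! (i - 1)"

definition contains :: "nat list \<Rightarrow> nat list \<Rightarrow> bool" where
  "contains w p \<longleftrightarrow> (\<exists>is. length is = length p \<and> sorted_wrt (<) is \<and>
      (\<forall>x\<in>set is. x < length w) \<and>
      (\<forall>a<length p. \<forall>b<length p.
          (w ! (is ! a) < w ! (is ! b) \<longleftrightarrow> p ! a < p ! b) \<and>
          (w ! (is ! a) = w ! (is ! b) \<longleftrightarrow> p ! a = p ! b)))"

definition avoids :: "nat list \<Rightarrow> nat list \<Rightarrow> bool" where
  "avoids w p \<longleftrightarrow> \<not> contains w p"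

definition inv_seqs :: "nat \<Rightarrow> nat list set" where
  "inv_seqs n = {e. length e = n \<and> (\<forall>i\<in>{1..n}. letter e i \<le> i - 1)}"

definition perms :: "nat \<Rightarrow> nat list set" where
  "perms n = {\<pi>. length \<pi> = n \<and> distinct \<pi> \<and> set \<pi> = {1..n}}"

definition DES :: "nat list \<Rightarrow> nat set" where
  "DES \<pi> = {i \<in> {1..<length \<pi>}. letter \<pi> i > letter \<pi> (i + 1)}"

definition VID :: "nat list \<Rightarrow> nat set" where
  "VID \<pi> = {i \<in> {1..length \<pi>}. letter \<pi> i < length \<pi> \<and>
             (\<exists>j\<in>{1..<i}. letter \<pi> j = letter \<pi> i + 1)}"

definition LMA :: "nat list \<Rightarrow> nat set" where
  "LMA \<pi> = {i \<in> {1..length \<pi>}. \<forall>j\<in>{1..<i}. letter \<pi> i > letter \<pi> j}"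

definition LMI :: "nat list \<Rightarrow> nat set" where
  "LMI \<pi> = {i \<in> {1..length \<pi>}. \<forall>j\<in>{1..<i}. letter \<pi> i < letter \<pi> j}"

definition RMA :: "nat list \<Rightarrow> nat set" where
  "RMA \<pi> = {i \<in> {1..length \<pi>}. \<forall>j\<in>{i<..length \<pi>}. letter \<pi> i > letter \<pi> j}"

text \<open>RMI is the same definition for permutations and inversion sequences.\<close>
definition RMI :: "nat list \<Rightarrow> nat set" where
  "RMI w = {i \<in> {1..length w}. \<forall>j\<in>{i<..length w}. letter w i < letter w j}"

definition ASC :: "nat list \<Rightarrow> nat set" where
  "ASC e = {i \<in> {1..<length e}. letter e i < letter e (i + 1)}"

definition DIST :: "nat list \<Rightarrow> nat set" where
  "DIST e = {i \<in> {2..length e}. letter e i \<noteq> 0 \<and>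
              (\<forall>j\<in>{i<..length e}. letter e i \<noteq> letter e j)}"

definition ZERO :: "nat list \<Rightarrow> nat set" where
  "ZERO e = {i \<in> {1..length e}. letter e i = 0}"

definition EMA :: "nat list \<Rightarrow> nat set" where
  "EMA e = {i \<in> {1..length e}. letter e i = i - 1}"

definition dval :: "nat list \<Rightarrow> nat \<Rightarrow> nat" where
  "dval e i = (if letter e i \<noteq> 0 then letter e i else Max (letter e ` {1..i}))"

definition covered :: "nat list \<Rightarrow> nat set" where
  "covered e = {i \<in> {1..length e}. letter e i = 0 \<and>
     (\<exists>a b. 1 \<le> a \<and> a < i \<and> i < b \<and> b \<le> length e \<and>
            letter e a = letter e b \<and> letter e a \<noteq> 0)}"

definition EXPO :: "nat list \<Rightarrow> nat set" where
  "EXPO e = {i \<in> {1..length e}. i \<notin> covered e \<and>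
     (\<forall>j\<in>{i<..length e}. int i - int (dval e i) < int j - int (dval e j))}"

end

theory Submission
  imports Defs
begin

text \<open>
  Both classes are described by the same trees, with the recursion
  \<open>S\<^sub>n = S\<^sub>n\<^sub>-\<^sub>1 + \<Sum>m. S\<^sub>m S\<^sub>n\<^sub>-\<^sub>m\<close> of the large Schroeder numbers, and all six statistics obey
  the same rule at every tree node.

  A permutation of the class that does not start with 1 has the form \<open>A 1 B\<close> with \<open>A\<close> nonempty.
  Avoidance of 2413 and 4213 forces the values of \<open>A\<close> to form an interval, so the permutation is
  given by \<open>A\<close> and by the permutation \<open>a B\<close> in which \<open>A\<close> is contracted to one letter.
  A 021-avoiding inversion sequence is one whose nonzero entries increase weakly.
  Cut it at its last entry \<open>e\<^sub>i = i - 1\<close>, the counterpart of the letter 1, where now \<open>i > 1\<close>.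
  The part before it is arbitrary, and the nonzero entries of the part after it are at least \<open>i - 1\<close>, so that the
  latter is a 021-avoiding inversion sequence up to a common shift of its nonzero entries.
  The statistics DIST and VID at position \<open>i\<close> dictate this shift: the value \<open>i - 1\<close> must occur
  again precisely when the contracted permutation does not start with its smallest letter, i.e. when
  the corresponding inversion sequence has an entry \<open>e\<^sub>k = k - 1\<close> with \<open>k > 1\<close>.
\<close>

section \<open>Inversion sequences avoiding 021\<close>

text \<open>Indices start at 0, hence the bound \<open>e ! i \<le> i\<close>. The first entry is
  then 0 and can play the 0 of the pattern, so avoidance becomes weak growth of the nonzero
  entries.\<close>

definition seq021 :: "nat list \<Rightarrow> bool" where
  "seq021 e \<longleftrightarrow> e \<noteq> [] \<and> (\<forall>i<length e. e ! i \<le> i) \<and>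
     (\<forall>i j. i < j \<longrightarrow> j < length e \<longrightarrow> e ! i \<noteq> 0 \<longrightarrow> e ! j \<noteq> 0 \<longrightarrow> e ! i \<le> e ! j)"

text \<open>Index 0 is left out because every sequence of the class starts with 0; what matters is a
  further entry equal to its index.\<close>

definition has_ema :: "nat list \<Rightarrow> bool" where
  "has_ema g \<longleftrightarrow> (\<exists>k<length g. 0 < k \<and> g ! k = k)"

definition offset :: "nat list \<Rightarrow> nat" where
  "offset g = (if has_ema g then LEAST c. c \<noteq> 0 \<and> c \<in> set g else 0)"

text \<open>The shift is the smallest one in the case \<open>has_ema g\<close>, so that \<open>length e\<close> itself becomes
  an entry after the cut, and otherwise all nonzero entries there exceed \<open>length e\<close>.\<close>

definition glueE :: "nat list \<Rightarrow> nat list \<Rightarrow> nat list" where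
  "glueE e g = e @ length e # map (\<lambda>x. if x = 0 then 0 else x - offset g + length e) (tl g)"

lemma seq021_le: "seq021 e \<Longrightarrow> i < length e \<Longrightarrow> e ! i \<le> i"
  by (simp add: seq021_def)

lemma seq021_mono:
  "seq021 e \<Longrightarrow> i \<le> j \<Longrightarrow> j < length e \<Longrightarrow> e ! i \<noteq> 0 \<Longrightarrow> e ! j \<noteq> 0 \<Longrightarrow> e ! i \<le> e ! j"
  unfolding seq021_def by (metis le_less)

lemma seq021_0: "seq021 e \<Longrightarrow> e ! 0 = 0"
  unfolding seq021_def by auto

lemma seq021_length: "seq021 e \<Longrightarrow> 0 < length e"
  unfolding seq021_def by auto

lemma offset_no_ema: "\<not> has_ema g \<Longrightarrow> offset g = 0"
  by (simp add: offset_def)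

lemma offset_has_ema:
  assumes "has_ema g"
  shows "0 < offset g" "offset g \<in> set g" "\<And>x. x \<in> set g \<Longrightarrow> x \<noteq> 0 \<Longrightarrow> offset g \<le> x"
proof -
  obtain k where k: "k < length g" "0 < k" "g ! k = k" using assms by (auto simp: has_ema_def)
  then have "k \<noteq> 0 \<and> k \<in> set g" by (metis nth_mem neq0_conv)
  then have "offset g \<noteq> 0 \<and> offset g \<in> set g"
    using assms LeastI[of "\<lambda>c. c \<noteq> 0 \<and> c \<in> set g" k] by (simp add: offset_def)
  then show "0 < offset g" "offset g \<in> set g" by auto
  show "\<And>x. x \<in> set g \<Longrightarrow> x \<noteq> 0 \<Longrightarrow> offset g \<le> x"
    using assms by (simp add: offset_def Least_le)
qed

lemma offset_le: "k < length g \<Longrightarrow> g ! k \<noteq> 0 \<Longrightarrow> offset g \<le> g ! k"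
  by (cases "has_ema g") (auto simp: offset_no_ema offset_has_ema)

lemma offset_eqI:
  assumes "q < length g" "0 < q" "g ! q = q" "c \<noteq> 0" "c \<in> set g"
    "\<And>x. x \<in> set g \<Longrightarrow> x \<noteq> 0 \<Longrightarrow> c \<le> x"
  shows "offset g = c"
proof -
  have "has_ema g" using assms by (auto simp: has_ema_def)
  from offset_has_ema[OF this] assms(4-6) show ?thesis by (metis le_antisym neq0_conv)
qed

text \<open>Either the offset is positive, or no positive index \<open>k\<close> of \<open>g\<close>
  carries the value \<open>k\<close>. Both make the inequality strict, so no entry after the cut
  will equal its index.\<close>

lemma offset_lt:
  assumes "seq021 g" "0 < k" "k < length g" "g ! k \<noteq> 0"
  shows "g ! k - offset g < k"
proof (cases "has_ema g")
  case True
  then show ?thesis using offset_has_ema(1)[OF True] seq021_le[OF assms(1,3)] offset_le[OF assms(3,4)]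
    by linarith
next
  case False
  then have "g ! k \<noteq> k" using assms by (auto simp: has_ema_def)
  then show ?thesis using seq021_le[OF assms(1,3)] by linarith
qed

section \<open>Words made of a prefix, a cut letter and a rest\<close>

lemma glue_index_cases:
  assumes "i < m + N"
  obtains "i < m" | "i = m" | k where "0 < k" "k < N" "i = m + (k::nat)"
proof -
  consider "i < m" | "i = m" | "i > m" by linarith
  then show ?thesis
  proof cases
    case 3
    then show ?thesis using assms that(3)[of "i - m"] by simp
  qed (use that in auto)
qed

text \<open>Index \<open>k > 0\<close> of the second word is sent to \<open>m + k\<close>, while its
  index 0 gives way to the cut letter at \<open>m\<close>.\<close>

lemma all_glue_index:
  fixes m N :: nat
  assumes "0 < N"
  shows "(\<forall>j<m + N. R j) \<longleftrightarrow> (\<forall>j<m. R j) \<and> R m \<and> (\<forall>k<N. 0 < k \<longrightarrow> R (m + k))"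
  using assms by (auto elim: glue_index_cases)

lemma ex_glue_index:
  fixes m N :: nat
  assumes "0 < N"
  shows "(\<exists>j<m + N. R j) \<longleftrightarrow> (\<exists>j<m. R j) \<or> R m \<or> (\<exists>k<N. 0 < k \<and> R (m + k))"
  using all_glue_index[OF assms, where R = "\<lambda>j. \<not> R j"] by blast

lemma length_glueE: "g \<noteq> [] \<Longrightarrow> length (glueE e g) = length e + length g"
  by (cases g) (auto simp: glueE_def)

lemma glueE_nth:
  "i < length e \<Longrightarrow> glueE e g ! i = e ! i"
  "glueE e g ! length e = length e"
  "0 < k \<Longrightarrow> k < length g \<Longrightarrow> glueE e g ! (length e + k) =
     (if g ! k = 0 then 0 else g ! k - offset g + length e)"
  by (auto simp: glueE_def nth_append nth_tl nth_Cons split: nat.split)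

text \<open>Prefix entries are below \<open>length e\<close>, the cut entry equals it, and later
  nonzero entries are at least \<open>length e\<close>. Monotonicity could thus fail only inside one
  block, where it is inherited.\<close>

lemma seq021_glueE:
  assumes e: "seq021 e" and g: "seq021 g"
  shows "seq021 (glueE e g)"
proof -
  let ?m = "length e" and ?G = "glueE e g"
  have N: "0 < length g" "g \<noteq> []" using seq021_length[OF g] by auto
  have len: "length ?G = ?m + length g" using N length_glueE by blast
  have le: "?G ! i \<le> i" if "i < ?m + length g" for i
    using that
  proof (cases rule: glue_index_cases)
    case 1 then show ?thesis using seq021_le[OF e] by (simp add: glueE_nth)
  next
    case 2 then show ?thesis by (simp add: glueE_nth)
  next
    case (3 k) then show ?thesis using offset_lt[OF g, of k] by (auto simp: glueE_nth)
  qed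
  have mono: "?G ! i \<le> ?G ! j" if ij: "i < j" "j < ?m + length g" "?G ! i \<noteq> 0" "?G ! j \<noteq> 0" for i j
    using ij(2)
  proof (cases rule: glue_index_cases)
    case 1 then show ?thesis using ij seq021_mono[OF e, of i j] by (simp add: glueE_nth)
  next
    case 2 then show ?thesis using le[of i] ij by (simp add: glueE_nth)
  next
    case (3 k)
    then have Gj: "?G ! j = g ! k - offset g + ?m" "g ! k \<noteq> 0" using ij by (auto simp: glueE_nth split: if_splits)
    show ?thesis
    proof (cases "i \<le> ?m")
      case True
      then show ?thesis using le[of i] N Gj by linarith
    next
      case False
      then obtain l where l: "0 < l" "i = ?m + l" "l < k" using ij 3
        by (metis add_less_cancel_left less_imp_add_positive linorder_not_less nat_less_le)
      then show ?thesis using ij 3 seq021_mono[OF g, of l k] Gj by (auto simp: glueE_nth split: if_splits)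
    qed
  qed
  show ?thesis using N len le mono unfolding seq021_def by (auto simp: glueE_def)
qed

lemma glueE_not_ema:
  assumes "seq021 g" "0 < k" "k < length g"
  shows "glueE e g ! (length e + k) < length e + k"
  using offset_lt[OF assms] assms by (auto simp: glueE_nth)

text \<open>The cut is recovered as the last entry equal to its index. The entries after it
  determine \<open>g\<close> only up to its offset, so it remains to see that the two offsets
  agree.\<close>

lemma glueE_inject:
  assumes "seq021 e" "seq021 g" "seq021 e'" "seq021 g'" and eq: "glueE e g = glueE e' g'"
  shows "e = e' \<and> g = g'"
proof -
  have N: "0 < length g" "0 < length g'" using assms seq021_length by blast+
  have L: "length e + length g = length e' + length g'"
    using arg_cong[OF eq, of length] N by (simp add: length_glueE)
  \<comment> \<open>A longer prefix \<open>a'\<close> would put an entry equal to its index at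
    \<open>length a'\<close>, strictly after the cut of the other word, where
    \<open>glueE_not_ema\<close> forbids it.\<close>
  have not_less: False
    if H: "seq021 b" "seq021 b'" "length a + length b = length a' + length b'" "glueE a b = glueE a' b'" "length a < length a'"
    for a b a' b' :: "nat list"
  proof -
    obtain k where k: "0 < k" "length a' = length a + k" using that[of "length a' - length a"] H(5) by simp
    have "k < length b" using H(3) k seq021_length[OF H(2)] by linarith
    then show False using glueE_not_ema[OF H(1) k(1), of a] glueE_nth(2)[of a' b'] k H(4) by simp
  qed
  have m: "length e = length e'"
    using not_less[OF assms(2,4) L eq] not_less[OF assms(4,2) L[symmetric] eq[symmetric]]
    by (cases "length e" "length e'" rule: linorder_cases) auto
  have ee: "e = e'" using eq m by (simp add: glueE_def)
  have lg: "length g = length g'" using L m by simp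
  have nth: "(if g ! k = 0 then 0 else g ! k - offset g + length e) =
     (if g' ! k = 0 then 0 else g' ! k - offset g' + length e)" if "0 < k" "k < length g" for k
  proof -
    have "glueE e g ! (length e + k) = glueE e' g' ! (length e' + k)" using eq m by simp
    moreover have "k < length g'" using that lg by simp
    ultimately show ?thesis
      using glueE_nth(3)[OF that, of e] glueE_nth(3)[OF that(1), of g' e'] m by argo
  qed
  \<comment> \<open>Since \<open>length e\<close> is positive, nonzero entries stay nonzero after
    the shift, so the zeros of both sequences can be compared.\<close>
  have me: "0 < length e" using assms(1) seq021_length by blast
  have zero: "g ! k = 0 \<longleftrightarrow> g' ! k = 0" if "k < length g" for k
    using nth[of k] that me seq021_0[OF assms(2)] seq021_0[OF assms(4)]
    by (cases "k = 0") (auto split: if_splits)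
  have diff: "g ! k - offset g = g' ! k - offset g'" if "k < length g" "g ! k \<noteq> 0" for k
    using nth[of k] that zero[of k] seq021_0[OF assms(2)] by (cases "k = 0") (auto split: if_splits)
  \<comment> \<open>At an index \<open>q\<close> with \<open>b ! q = q\<close> the entry of
    \<open>b\<close> is as large as possible, so equal differences force the offset of
    \<open>b'\<close> to be no larger.\<close>
  have ema_le: "offset b' \<le> offset b"
    if H: "seq021 b'" "length b = length b'" "\<And>k. k < length b \<Longrightarrow> b ! k \<noteq> 0 \<Longrightarrow> b' ! k \<noteq> 0 \<and> b ! k - offset b = b' ! k - offset b'"
      "has_ema b" for b b'
  proof -
    obtain q where q: "q < length b" "0 < q" "b ! q = q" using H(4) by (auto simp: has_ema_def)
    then show ?thesis using H(3)[of q] H(2) seq021_le[OF H(1), of q] offset_le[of q b] offset_le[of q b']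
      by linarith
  qed
  \<comment> \<open>In \<open>b\<close> the least nonzero entry has difference 0, whereas offset 0
    leaves every nonzero entry of \<open>b'\<close> a positive difference.\<close>
  have no_mixed: False
    if H: "length b = length b'" "\<And>k. k < length b \<Longrightarrow> b ! k \<noteq> 0 \<Longrightarrow> b' ! k \<noteq> 0 \<and> b ! k - offset b = b' ! k - offset b'"
      "has_ema b" "\<not> has_ema b'" for b b'
  proof -
    obtain q where q: "q < length b" "b ! q = offset b"
      using offset_has_ema(2)[OF H(3)] by (auto simp: in_set_conv_nth)
    then show False using H(2)[of q] offset_has_ema(1)[OF H(3)] offset_no_ema[OF H(4)] by auto
  qed
  have 1: "\<And>k. k < length g \<Longrightarrow> g ! k \<noteq> 0 \<Longrightarrow> g' ! k \<noteq> 0 \<and> g ! k - offset g = g' ! k - offset g'"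
    using zero diff by simp
  have 2: "\<And>k. k < length g' \<Longrightarrow> g' ! k \<noteq> 0 \<Longrightarrow> g ! k \<noteq> 0 \<and> g' ! k - offset g' = g ! k - offset g"
    using zero diff lg by simp
  have "offset g = offset g'"
  proof (cases "has_ema g")
    case True
    then have "has_ema g'" using no_mixed[OF lg 1] by blast
    then show ?thesis using ema_le[OF assms(4) lg 1 True] ema_le[OF assms(2) lg[symmetric] 2] by simp
  next
    case False
    then have "\<not> has_ema g'" using no_mixed[OF lg[symmetric] 2] by blast
    then show ?thesis using False by (simp add: offset_no_ema)
  qed
  then have "g ! k = g' ! k" if "k < length g" for k
    using zero[OF that] diff[OF that] offset_le[OF that] offset_le[of k g'] that lg
    by (cases "g ! k = 0") auto
  then show ?thesis using ee lg by (simp add: nth_equalityI)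
qed

lemma seq021_Cons0:
  assumes "seq021 e"
  shows "seq021 (0 # e)"
  using assms unfolding seq021_def
  by (auto simp: nth_Cons split: nat.splits intro: le_SucI)

text \<open>Without an entry equal to its positive index, dropping the leading 0 keeps every entry
  within its bound. Otherwise the last such entry is the cut, and the work lies in undoing the shift
  of the rest.\<close>

lemma seq021_decompose:
  assumes e: "seq021 e" and len: "2 \<le> length e"
  shows "(\<exists>g. seq021 g \<and> e = 0 # g) \<or> (\<exists>a g. seq021 a \<and> seq021 g \<and> e = glueE a g)"
proof (cases "has_ema e")
  case False
  obtain g where g: "e = 0 # g" using seq021_0[OF e] len by (cases e) auto
  have "g ! i \<le> i" if "i < length g" for i
  proof -
    have "e ! Suc i \<le> Suc i" "e ! Suc i \<noteq> Suc i"
      using that g False seq021_le[OF e, of "Suc i"] by (auto simp: has_ema_def)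
    then show ?thesis using g by simp
  qed
  moreover have "g ! i \<le> g ! j" if "i < j" "j < length g" "g ! i \<noteq> 0" "g ! j \<noteq> 0" for i j
    using seq021_mono[OF e, of "Suc i" "Suc j"] that g by simp
  ultimately have "seq021 g" using g len unfolding seq021_def by auto
  then show ?thesis using g by blast
next
  case True
  define m where "m = Max {k. k < length e \<and> e ! k = k}"
  have fin: "finite {k. k < length e \<and> e ! k = k}" by simp
  obtain q where q: "q < length e" "0 < q" "e ! q = q" using True by (auto simp: has_ema_def)
  then have m: "m < length e" "e ! m = m" using Max_in[OF fin] by (auto simp: m_def simp del: Max_less_iff)
  have max: "k \<le> m" if "k < length e" "e ! k = k" for k
    unfolding m_def using that by (intro Max_ge[OF fin]) simp
  have m0: "0 < m" using max[of q] q by simp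
  have after: "e ! k < k" if "m < k" "k < length e" for k
    using max[of k] that seq021_le[OF e, of k] by linarith
  \<comment> \<open>\<open>N\<close> counts the cut together with the entries after it, as the cut
    stands in for the head of the second sequence; \<open>r\<close> indexes these entries by their
    distance from the cut.\<close>
  define N where "N = length e - m"
  define r where "r k = e ! (m + k)" for k
  have N: "0 < N" "length e = m + N" using m by (auto simp: N_def)
  have r_lt: "r k < m + k" if "0 < k" "k < N" for k using after[of "m + k"] that N by (simp add: r_def)
  have r_ge: "m \<le> r k" if "0 < k" "k < N" "r k \<noteq> 0" for k
    using seq021_mono[OF e, of m "m + k"] that N m m0 by (simp add: r_def)
  have r_mono: "r k \<le> r l" if "0 < k" "k < l" "l < N" "r k \<noteq> 0" "r l \<noteq> 0" for k l
    using seq021_mono[OF e, of "m + k" "m + l"] that N by (simp add: r_def)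
  define a where "a = take m e"
  have a: "seq021 a" using e m m0 unfolding seq021_def a_def by auto
  have la: "length a = m" using m by (simp add: a_def)
  have glue: "e = glueE a g"
    if "length g = N" "\<And>k. 0 < k \<Longrightarrow> k < N \<Longrightarrow> r k = (if g ! k = 0 then 0 else g ! k - offset g + m)" for g
  proof (rule nth_equalityI)
    have ne: "g \<noteq> []" using that N by auto
    show "length e = length (glueE a g)" using N that la length_glueE[OF ne] by simp
    fix i assume "i < length e"
    then have "i < m + N" using N by simp
    then show "e ! i = glueE a g ! i"
    proof (cases rule: glue_index_cases)
      case 1 then show ?thesis using la by (simp add: glueE_nth) (simp add: a_def)
    next
      case 2 then show ?thesis using la m glueE_nth(2)[of a g] by simp
    next
      case (3 k) then show ?thesis using la that glueE_nth(3)[of k g a] by (simp add: r_def)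
    qed
  qed
  show ?thesis
  proof (cases "\<exists>k<N. 0 < k \<and> r k = m")
    case False
    \<comment> \<open>The value \<open>m\<close> does not recur, so lowering by \<open>m\<close>
      keeps nonzero entries nonzero, and \<open>r_lt\<close> keeps each one below its index: this is
      the case of offset 0.\<close>
    define g where "g = map (\<lambda>k. if k = 0 then 0 else r k - m) [0..<N]"
    have lg: "length g = N" by (simp add: g_def)
    have gk: "g ! k = (if k = 0 then 0 else r k - m)" if "k < N" for k using that by (simp add: g_def)
    have "seq021 g" unfolding seq021_def
    proof (intro conjI allI impI)
      show "g \<noteq> []" using lg N by auto
    next
      fix i assume "i < length g" then show "g ! i \<le> i" using r_lt[of i] lg gk[of i] by auto
    next
      fix i j assume "i < j" "j < length g" "g ! i \<noteq> 0" "g ! j \<noteq> 0"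
      then show "g ! i \<le> g ! j" using lg gk[of i] gk[of j] r_mono[of i j] by (auto split: if_splits)
    qed
    have ne: "\<not> has_ema g"
    proof
      assume "has_ema g"
      then obtain k where "k < N" "0 < k" "g ! k = k" using lg by (auto simp: has_ema_def)
      then show False using r_lt[of k] gk[of k] by simp
    qed
    have "e = glueE a g"
    proof (rule glue[OF lg])
      fix k assume k: "0 < k" "k < N"
      then have "r k \<noteq> m" using False by blast
      then show "r k = (if g ! k = 0 then 0 else g ! k - offset g + m)"
        using r_ge[OF k] gk[OF k(2)] k offset_no_ema[OF ne] by (cases "r k = 0") auto
    qed
    then show ?thesis using a \<open>seq021 g\<close> by blast
  next
    case True
    define K where "K = {k. k < N \<and> 0 < k \<and> r k \<noteq> 0}"
    \<comment> \<open>The largest raise after which no entry exceeds its index. The minimum is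
      attained at \<open>q\<close>, which thereby gets \<open>g ! q = q\<close>; the recurrence of
      \<open>m\<close> at \<open>p\<close> becomes the least nonzero entry, so
      \<open>offset g\<close> is exactly \<open>c\<close>.\<close>
    define c where "c = Min ((\<lambda>k. k - (r k - m)) ` K)"
    have finK: "finite ((\<lambda>k. k - (r k - m)) ` K)" by (simp add: K_def)
    obtain p where p: "p < N" "0 < p" "r p = m" using True by blast
    then have pK: "p \<in> K" using m0 by (simp add: K_def)
    then have "c \<in> (\<lambda>k. k - (r k - m)) ` K" unfolding c_def using Min_in[OF finK] by blast
    then obtain q where q: "q \<in> K" "c = q - (r q - m)" by blast
    have c_le: "c \<le> k - (r k - m)" if "k \<in> K" for k unfolding c_def using finK that by simp
    have c0: "0 < c" using q r_lt[of q] m0 by (auto simp: K_def)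
    define g where "g = map (\<lambda>k. if k = 0 \<or> r k = 0 then 0 else r k - m + c) [0..<N]"
    have lg: "length g = N" by (simp add: g_def)
    have gk: "g ! k = (if k = 0 \<or> r k = 0 then 0 else r k - m + c)" if "k < N" for k using that by (simp add: g_def)
    have "seq021 g" unfolding seq021_def
    proof (intro conjI allI impI)
      show "g \<noteq> []" using lg N by auto
    next
      fix i assume "i < length g" then show "g ! i \<le> i" using r_lt[of i] lg gk[of i] c_le[of i]
        by (auto simp: K_def)
    next
      fix i j assume "i < j" "j < length g" "g ! i \<noteq> 0" "g ! j \<noteq> 0"
      then show "g ! i \<le> g ! j" using lg gk[of i] gk[of j] r_mono[of i j] by (auto split: if_splits)
    qed
    have "offset g = c"
    proof (rule offset_eqI[of q])
      show "q < length g" "0 < q" using q lg by (auto simp: K_def)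
      show "g ! q = q" using q gk[of q] r_lt[of q] by (auto simp: K_def)
      show "c \<noteq> 0" using c0 by simp
      have "g ! p = c" using gk[of p] p m0 by simp
      then show "c \<in> set g" using p lg by (metis nth_mem)
      fix x assume "x \<in> set g" "x \<noteq> 0"
      then obtain k where "k < N" "x = g ! k" using lg by (auto simp: in_set_conv_nth)
      then show "c \<le> x" using gk[of k] \<open>x \<noteq> 0\<close> by (auto split: if_splits)
    qed
    then have "r k = (if g ! k = 0 then 0 else g ! k - offset g + m)" if "0 < k" "k < N" for k
      using gk[OF that(2)] r_ge[OF that] that c0 by auto
    then have "e = glueE a g" by (rule glue[OF lg])
    then show ?thesis using a \<open>seq021 g\<close> by blast
  qed
qed

section \<open>Permutations avoiding 2413 and 4213\<close>

text \<open>The order of \<open>i\<close> and \<open>j\<close> is left open: \<open>i < j\<close>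
  gives the pattern 2413 and \<open>j < i\<close> gives 4213. Distinct letters in
  \<open>{1..length p}\<close> exhaust this range.\<close>

definition schroeder_perm :: "nat list \<Rightarrow> bool" where
  "schroeder_perm p \<longleftrightarrow> p \<noteq> [] \<and> distinct p \<and> set p \<subseteq> {1..length p} \<and>
     (\<forall>i j k l. i < k \<longrightarrow> j < k \<longrightarrow> k < l \<longrightarrow> l < length p \<longrightarrow>
        \<not> (p ! k < p ! i \<and> p ! i < p ! l \<and> p ! l < p ! j))"

text \<open>Inflation of the first letter of \<open>q\<close> by \<open>p\<close>, with a new
  minimum 1 right after the block. The new minimum raises all letters by 1, and the block raises
  those above it by a further \<open>length p - 1\<close>.\<close>

definition glueP :: "nat list \<Rightarrow> nat list \<Rightarrow> nat list" where
  "glueP p q = map (\<lambda>x. x + q ! 0) p @ 1 # map (\<lambda>x. if x < q ! 0 then x + 1 else x + length p) (tl q)"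

lemma schroeder_perm_length: "schroeder_perm p \<Longrightarrow> 0 < length p"
  by (simp add: schroeder_perm_def)

\<comment> \<open>Keeps \<open>0 < length p\<close> usable for linear arithmetic.\<close>
declare length_greater_0_conv [simp del]

lemma schroeder_perm_range:
  assumes "schroeder_perm p" "i < length p"
  shows "1 \<le> p ! i" "p ! i \<le> length p"
proof -
  have "p ! i \<in> {1..length p}"
    using assms nth_mem[OF assms(2)] unfolding schroeder_perm_def by blast
  then show "1 \<le> p ! i" "p ! i \<le> length p" by auto
qed

lemma schroeder_perm_eq:
  "schroeder_perm p \<Longrightarrow> i < length p \<Longrightarrow> j < length p \<Longrightarrow> p ! i = p ! j \<longleftrightarrow> i = j"
  unfolding schroeder_perm_def by (auto simp: nth_eq_iff_index_eq)

lemma distinct_subset_atLeastAtMost: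
  "distinct p \<Longrightarrow> set p \<subseteq> {1..length p} \<Longrightarrow> set p = {1..length p}"
  by (metis card_atLeastAtMost card_subset_eq diff_Suc_1 distinct_card finite_atLeastAtMost)

lemma schroeder_perm_set: "schroeder_perm p \<Longrightarrow> set p = {1..length p}"
  unfolding schroeder_perm_def using distinct_subset_atLeastAtMost by blast

lemma schroeder_perm_1:
  assumes "schroeder_perm p"
  obtains k where "k < length p" "p ! k = 1"
proof -
  have "1 \<in> set p" using schroeder_perm_set[OF assms] schroeder_perm_length[OF assms] by simp
  then show ?thesis using that by (auto simp: in_set_conv_nth)
qed

lemma schroeder_permI:
  assumes "p \<noteq> []" "\<And>i. i < length p \<Longrightarrow> 1 \<le> p ! i \<and> p ! i \<le> length p"
    "\<And>i j. i < j \<Longrightarrow> j < length p \<Longrightarrow> p ! i \<noteq> p ! j"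
    "\<And>i j k l. i < k \<Longrightarrow> j < k \<Longrightarrow> k < l \<Longrightarrow> l < length p \<Longrightarrow>
       p ! k < p ! i \<Longrightarrow> p ! i < p ! l \<Longrightarrow> p ! l < p ! j \<Longrightarrow> False"
  shows "schroeder_perm p"
proof -
  have "distinct p" unfolding distinct_conv_nth by (metis assms(3) nat_neq_iff)
  moreover have "set p \<subseteq> {1..length p}" using assms(2) by (auto simp: in_set_conv_nth)
  ultimately show ?thesis using assms unfolding schroeder_perm_def by blast
qed

lemma schroeder_permD:
  "schroeder_perm p \<Longrightarrow> i < k \<Longrightarrow> j < k \<Longrightarrow> k < l \<Longrightarrow> l < length p \<Longrightarrow>
       p ! k < p ! i \<Longrightarrow> p ! i < p ! l \<Longrightarrow> p ! l < p ! j \<Longrightarrow> False"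
  unfolding schroeder_perm_def by blast

lemma length_glueP: "q \<noteq> [] \<Longrightarrow> length (glueP p q) = length p + length q"
  by (cases q) (auto simp: glueP_def)

lemma glueP_nth:
  "i < length p \<Longrightarrow> glueP p q ! i = p ! i + q ! 0"
  "glueP p q ! length p = 1"
  "0 < k \<Longrightarrow> k < length q \<Longrightarrow> glueP p q ! (length p + k) =
     (if q ! k < q ! 0 then q ! k + 1 else q ! k + length p)"
  by (auto simp: glueP_def nth_append nth_tl nth_Cons split: nat.split)

context
  fixes p q :: "nat list"
  assumes p: "schroeder_perm p" and q: "schroeder_perm q"
begin

lemma glueP_length: "length (glueP p q) = length p + length q"
  using length_glueP schroeder_perm_length[OF q] by blast

lemma glueP_bounds:
  assumes "i < length p"
  shows "q ! 0 < glueP p q ! i" "glueP p q ! i \<le> q ! 0 + length p"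
  using schroeder_perm_range[OF p assms] assms by (auto simp: glueP_nth)

lemma glueP_gt_1:
  assumes "i < length p + length q" "i \<noteq> length p"
  shows "1 < glueP p q ! i"
  using assms(1)
proof (cases rule: glue_index_cases)
  case 1 then show ?thesis using glueP_bounds[of i] schroeder_perm_range[OF q, of 0] schroeder_perm_length[OF q] by simp
next
  case (3 k) then show ?thesis using schroeder_perm_range(1)[OF q, of k] schroeder_perm_length[OF p]
    by (auto simp: glueP_nth)
qed (use assms in auto)

text \<open>The prefix fills an interval of values that no later letter enters, so each of its
  letters compares with a later one as the contracted letter \<open>q ! 0\<close> does.\<close>

lemma glueP_less_prefix:
  assumes "i < length p" "0 < k" "k < length q"
  shows "glueP p q ! i < glueP p q ! (length p + k) \<longleftrightarrow> q ! 0 < q ! k"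
    "glueP p q ! (length p + k) < glueP p q ! i \<longleftrightarrow> q ! k < q ! 0"
  using glueP_bounds[OF assms(1)] assms schroeder_perm_eq[OF q assms(3), of 0] schroeder_perm_length[OF q]
  by (auto simp: glueP_nth(3))

lemma glueP_less_suffix:
  assumes "0 < l" "l < length q" "0 < k" "k < length q"
  shows "glueP p q ! (length p + l) < glueP p q ! (length p + k) \<longleftrightarrow> q ! l < q ! k"
  using assms schroeder_perm_eq[OF q, of l 0] schroeder_perm_eq[OF q, of k 0]
    schroeder_perm_length[OF p] schroeder_perm_length[OF q]
  by (auto simp: glueP_nth(3))

lemma schroeder_perm_glueP: "schroeder_perm (glueP p q)"
proof (rule schroeder_permI)
  let ?G = "glueP p q" and ?m = "length p" and ?N = "length q"
  have mN: "0 < ?m" "0 < ?N" using p q schroeder_perm_length by blast+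
  show "?G \<noteq> []" by (simp add: glueP_def)
  show "1 \<le> ?G ! i \<and> ?G ! i \<le> length ?G" if "i < length ?G" for i
  proof -
    have "i < ?m + ?N" using that glueP_length by simp
    then show ?thesis
    proof (cases rule: glue_index_cases)
      case 1 then show ?thesis
        using glueP_bounds[of i] schroeder_perm_range[OF q mN(2)] by (auto simp: glueP_length)
    next
      case 2 then show ?thesis using mN glueP_length by (auto simp: glueP_nth)
    next
      case (3 k) then show ?thesis using schroeder_perm_range[OF q, of k] mN glueP_length by (auto simp: glueP_nth)
    qed
  qed
  show "?G ! i \<noteq> ?G ! j" if "i < j" "j < length ?G" for i j
  proof -
    have "j < ?m + ?N" using that glueP_length by simp
    then show ?thesis
    proof (cases rule: glue_index_cases)
      case 1 then show ?thesis using that schroeder_perm_eq[OF p, of i j] by (auto simp: glueP_nth)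
    next
      case 2 then show ?thesis using that glueP_gt_1[of i] glueP_length by (auto simp: glueP_nth)
    next
      case (3 k)
      have "i < ?m + ?N" using that glueP_length by simp
      then show ?thesis
      proof (cases rule: glue_index_cases)
        case 1 then show ?thesis using 3 glueP_less_prefix[of i k] schroeder_perm_eq[OF q, of k 0] mN
          by (metis less_irrefl_nat nat_neq_iff)
      next
        case 2 then show ?thesis using 3 glueP_gt_1[of j] that(2) glueP_length by (auto simp: glueP_nth)
      next
        case l: (3 l) then show ?thesis using 3 glueP_less_suffix[of l k] glueP_less_suffix[of k l] schroeder_perm_eq[OF q, of k l] that
          by (metis less_irrefl_nat nat_neq_iff)
      qed
    qed
  qed
  fix i j k l
  assume idx: "i < k" "j < k" "k < l" "l < length ?G"
    and vals: "?G ! k < ?G ! i" "?G ! i < ?G ! l" "?G ! l < ?G ! j"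
  have "l < ?m + ?N" using idx glueP_length by simp
  then show False
  proof (cases rule: glue_index_cases)
    case 1 then show ?thesis using vals idx schroeder_permD[OF p, of i k j l] by (auto simp: glueP_nth)
  next
    case 2 then show ?thesis using vals idx glueP_gt_1[of i] by (auto simp: glueP_nth)
  next
    case L: (3 l')
    have ne1: "i \<noteq> ?m" "j \<noteq> ?m" using vals glueP_nth(2)[of p q] glueP_gt_1[of k] glueP_gt_1[of l] idx glueP_length L by auto
    have iN: "i < ?m + ?N" "j < ?m + ?N" "k < ?m + ?N" using idx glueP_length by auto
    \<comment> \<open>\<open>h\<close> contracts the prefix to index 0 of \<open>q\<close>; a
      forbidden quadruple ending after the cut is carried over to \<open>q\<close> along it.\<close>
    define h where "h x = (if x < ?m then 0 else x - ?m)" for x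
    have lt: "?G ! x < ?G ! y \<longleftrightarrow> q ! h x < q ! h y"
      if "x < ?m + ?N" "y < ?m + ?N" "x \<noteq> ?m" "y \<noteq> ?m" "\<not> (x < ?m \<and> y < ?m)" for x y
    proof -
      have "x < ?m \<and> h x = 0 \<or> 0 < h x \<and> h x < ?N \<and> x = ?m + h x"
        "y < ?m \<and> h y = 0 \<or> 0 < h y \<and> h y < ?N \<and> y = ?m + h y"
        using that by (auto simp: h_def)
      then show ?thesis using that(5) glueP_less_prefix glueP_less_suffix by metis
    qed
    have hl: "h l = l'" "\<not> l < ?m" "l \<noteq> ?m" using L by (auto simp: h_def)
    have "q ! h i < q ! l'" "q ! l' < q ! h j"
      using vals lt[of i l] lt[of l j] iN ne1 hl L by auto
    \<comment> \<open>Two prefix letters cannot have the letter at \<open>l\<close> between them, so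
      one of \<open>i\<close>, \<open>j\<close>, and hence \<open>k\<close>, lies after the
      cut.\<close>
    then have "\<not> (i < ?m \<and> j < ?m)" by (auto simp: h_def)
    then have k: "?m < k" using idx ne1 by auto
    then have "q ! h k < q ! h i" using vals lt[of k i] iN ne1 by auto
    moreover have "h i < h k" "h j < h k" "h k < l'" using idx k L by (auto simp: h_def)
    ultimately show False using schroeder_permD[OF q, of "h i" "h k" "h j" l'] \<open>q ! h i < q ! l'\<close> \<open>q ! l' < q ! h j\<close> L
      by blast
  qed
qed

lemma glueP_eq_1: "i < length p + length q \<Longrightarrow> glueP p q ! i = 1 \<longleftrightarrow> i = length p"
  using glueP_gt_1[of i] glueP_nth(2)[of p q] by (cases "i = length p") auto

end

text \<open>The letter 1 marks the cut, and the least prefix letter exceeds the contracted letter by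
  one; both can be read off the glued word.\<close>

lemma glueP_inject:
  assumes "schroeder_perm p" "schroeder_perm q" "schroeder_perm p'" "schroeder_perm q'"
    and eq: "glueP p q = glueP p' q'"
  shows "p = p' \<and> q = q'"
proof -
  have N: "0 < length q" "0 < length q'" "0 < length p" using assms schroeder_perm_length by blast+
  have L: "length p + length q = length p' + length q'"
    using glueP_length[OF assms(1,2)] glueP_length[OF assms(3,4)] eq by simp
  have m: "length p = length p'"
    using glueP_eq_1[OF assms(1,2), of "length p"] glueP_eq_1[OF assms(3,4), of "length p"] L N eq by simp
  have lq: "length q = length q'" using L m by simp
  have pre: "p ! i + q ! 0 = p' ! i + q' ! 0" if "i < length p" for i
    using that glueP_nth(1)[of i p q] glueP_nth(1)[of i p' q'] eq m by simp
  \<comment> \<open>Where \<open>a'\<close> has its letter 1 the common prefix letter is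
    \<open>b' ! 0 + 1\<close>, and \<open>a\<close> contributes at least 1 there.\<close>
  have 1: "b ! 0 \<le> b' ! 0" if H: "schroeder_perm a" "schroeder_perm a'" "length a = length a'"
    "\<And>i. i < length a \<Longrightarrow> a ! i + b ! 0 = a' ! i + b' ! 0" for a a' b b' :: "nat list"
  proof -
    obtain i where "i < length a'" "a' ! i = 1" using schroeder_perm_1[OF H(2)] by blast
    then show ?thesis using H(3) H(4)[of i] schroeder_perm_range(1)[OF H(1), of i] by linarith
  qed
  have a: "q ! 0 = q' ! 0"
    using 1[OF assms(1,3) m pre] 1[OF assms(3,1) m[symmetric]] pre m by (metis le_antisym)
  have "p = p'" using pre a m by (simp add: nth_equalityI)
  moreover have "q ! k = q' ! k" if "k < length q" for k
  proof (cases "k = 0")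
    case False
    then show ?thesis
      using that a m lq glueP_nth(3)[of k q p] glueP_nth(3)[of k q' p'] eq N
        schroeder_perm_eq[OF assms(2), of k 0] schroeder_perm_eq[OF assms(4), of k 0]
      by (auto split: if_splits)
  qed (use a in simp)
  ultimately show ?thesis using lq by (simp add: nth_equalityI)
qed

lemma schroeder_perm_Cons1:
  assumes "schroeder_perm p"
  shows "schroeder_perm (1 # map Suc p)"
proof (rule schroeder_permI)
  show "1 \<le> (1 # map Suc p) ! i \<and> (1 # map Suc p) ! i \<le> length (1 # map Suc p)"
    if "i < length (1 # map Suc p)" for i
    using that schroeder_perm_range[OF assms, of "i - 1"] by (cases i) auto
  show "(1 # map Suc p) ! i \<noteq> (1 # map Suc p) ! j"
    if "i < j" "j < length (1 # map Suc p)" for i j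
    using that schroeder_perm_eq[OF assms, of "i - 1" "j - 1"] schroeder_perm_range[OF assms, of "j - 1"]
    by (cases j; cases i) auto
  fix i j k l
  assume *: "i < k" "j < k" "k < l" "l < length (1 # map Suc p)"
    "(1 # map Suc p) ! k < (1 # map Suc p) ! i"
    "(1 # map Suc p) ! i < (1 # map Suc p) ! l"
    "(1 # map Suc p) ! l < (1 # map Suc p) ! j"
  then show False
    using schroeder_permD[OF assms, of "i - 1" "k - 1" "j - 1" "l - 1"]
    by (cases i; cases j; cases k; cases l) auto
qed simp

lemma schroeder_perm_decompose:
  assumes s: "schroeder_perm s" and len: "2 \<le> length s"
  shows "(\<exists>p. schroeder_perm p \<and> s = 1 # map Suc p) \<or>
    (\<exists>p q. schroeder_perm p \<and> schroeder_perm q \<and> s = glueP p q)"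
proof -
  obtain m where m: "m < length s" "s ! m = 1" using schroeder_perm_1[OF s] by blast
  have gt1: "1 < s ! i" if "i < length s" "i \<noteq> m" for i
    using that schroeder_perm_eq[OF s, of i m] schroeder_perm_range[OF s, of i] m by auto
  show ?thesis
  proof (cases "m = 0")
    case True
    define p where "p = map (\<lambda>x. x - 1) (tl s)"
    have lp: "length s = Suc (length p)" using len by (simp add: p_def)
    have pn: "s ! Suc i = Suc (p ! i)" if "i < length p" for i
    proof -
      have "p ! i = s ! Suc i - 1" using that by (simp add: p_def nth_tl)
      then show ?thesis using gt1[of "Suc i"] True lp that by simp
    qed
    have "s = 1 # map Suc p"
    proof (rule nth_equalityI)
      fix i assume "i < length s"
      then show "s ! i = (1 # map Suc p) ! i" using m True lp pn by (cases i) auto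
    qed (use lp in simp)
    moreover have "schroeder_perm p"
    proof (rule schroeder_permI)
      show "p \<noteq> []" using lp len by auto
      show "1 \<le> p ! i \<and> p ! i \<le> length p" if "i < length p" for i
        using pn[OF that] gt1[of "Suc i"] schroeder_perm_range[OF s, of "Suc i"] True lp that by auto
      show "p ! i \<noteq> p ! j" if "i < j" "j < length p" for i j
        using pn[of i] pn[of j] schroeder_perm_eq[OF s, of "Suc i" "Suc j"] that lp by auto
      fix i j k l assume "i < k" "j < k" "k < l" "l < length p" "p ! k < p ! i" "p ! i < p ! l" "p ! l < p ! j"
      then show False using schroeder_permD[OF s, of "Suc i" "Suc k" "Suc j" "Suc l"] pn lp by simp
    qed
    ultimately show ?thesis by blast
  next
    case False
    \<comment> \<open>\<open>a\<close> is to become the contracted letter \<open>q ! 0\<close>: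
      below the prefix lie the values 1 to \<open>a\<close>, and deleting the letter 1 leaves
      \<open>a - 1\<close> of them.\<close>
    define a where "a = Min ((!) s ` {..<m}) - 1"
    define N where "N = length s - m"
    have N: "0 < N" "length s = m + N" using m by (auto simp: N_def)
    have ne: "(!) s ` {..<m} \<noteq> {}" "finite ((!) s ` {..<m})" using False by auto
    obtain i0 where i0: "i0 < m" "s ! i0 = Min ((!) s ` {..<m})"
      using Min_in[OF ne(2,1)] by auto
    then have i0a: "s ! i0 = Suc a" using gt1[of i0] m by (auto simp: a_def)
    have a1: "1 \<le> a" using gt1[of i0] i0 i0a m by auto
    have ge: "a < s ! i" if "i < m" for i
    proof -
      have "Min ((!) s ` {..<m}) \<le> s ! i" using that by (intro Min_le[OF ne(2)]) simp
      then show ?thesis using i0 i0a by linarith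
    qed
    text \<open>Since the letter 1 comes right after the prefix, a later letter between two prefix letters would
      complete a forbidden pattern, so the prefix occupies an interval of values.\<close>
    have sep: "(\<forall>i<m. s ! l < s ! i) \<or> (\<forall>i<m. s ! i < s ! l)" if l: "m < l" "l < length s" for l
    proof (rule ccontr)
      assume "\<not> ?thesis"
      then obtain i j where "i < m" "j < m" "s ! i \<le> s ! l" "s ! l \<le> s ! j" by (meson linorder_not_less)
      moreover have "s ! i \<noteq> s ! l" "s ! l \<noteq> s ! j" using \<open>i < m\<close> \<open>j < m\<close> l schroeder_perm_eq[OF s] m by auto
      ultimately show False using schroeder_permD[OF s, of i m j l] m gt1[of i] l by auto
    qed
    \<comment> \<open>By \<open>sep\<close>, a value between the least and the greatest prefix
      letter can only sit in the prefix; counting the \<open>m\<close> distinct letters then gives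
      the upper end.\<close>
    have interval: "(!) s ` {..<m} = {a + 1..a + m}"
    proof -
      let ?M = "Max ((!) s ` {..<m})"
      obtain j0 where j0: "j0 < m" "s ! j0 = ?M" using Max_in[OF ne(2,1)] by auto
      have "x \<in> (!) s ` {..<m}" if x: "a + 1 \<le> x" "x \<le> ?M" for x
      proof -
        have "x \<in> set s" using x schroeder_perm_set[OF s] schroeder_perm_range[OF s, of j0] j0 m by auto
        then obtain k where k: "k < length s" "s ! k = x" by (auto simp: in_set_conv_nth)
        have "k < m"
        proof (rule ccontr)
          assume "\<not> k < m"
          then have "m < k" using k m x a1 by (cases "k = m") auto
          then show False using sep[of k] k i0 i0a j0 x by force
        qed
        then show ?thesis using k by blast
      qed
      moreover have "a + 1 \<le> x \<and> x \<le> ?M" if "x \<in> (!) s ` {..<m}" for x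
        using Max_ge[OF ne(2) that] ge that by (auto simp: Suc_le_eq)
      ultimately have eq: "(!) s ` {..<m} = {a + 1..?M}" by (intro set_eqI) (meson atLeastAtMost_iff)
      have "inj_on ((!) s) {..<m}" using schroeder_perm_eq[OF s] m by (auto simp: inj_on_def)
      then have "card ((!) s ` {..<m}) = m" by (simp add: card_image)
      then have "?M - a = m" using arg_cong[OF eq, of card] by simp
      then have "?M = a + m" using False by linarith
      then show ?thesis using eq by simp
    qed
    have up: "s ! i \<le> a + m" if "i < m" for i using interval that by (metis atLeastAtMost_iff imageI lessThan_iff)
    obtain j0 where j0: "j0 < m" "s ! j0 = a + m"
    proof -
      have "a + m \<in> (!) s ` {..<m}" using interval False by simp
      then show ?thesis using that by auto
    qed
    have sep': "s ! l \<le> a \<or> a + m < s ! l" if "m < l" "l < length s" for l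
      using sep[OF that] i0 i0a j0 by force
    define p where "p = map (\<lambda>x. x - a) (take m s)"
    have lp: "length p = m" using m by (simp add: p_def)
    have pn: "s ! i = p ! i + a" if "i < m" for i using that ge[OF that] m by (simp add: p_def)
    \<comment> \<open>Removing the letter 1 lowers everything by 1; contracting the prefix lowers
      the letters above it by another \<open>m - 1\<close>.\<close>
    define q where "q = a # map (\<lambda>x. if x \<le> a then x - 1 else x - m) (drop (Suc m) s)"
    have lq: "length q = N" using m by (simp add: q_def N_def)
    have q0: "q ! 0 = a" by (simp add: q_def)
    have qn: "q ! k = (if s ! (m + k) \<le> a then s ! (m + k) - 1 else s ! (m + k) - m)" if "0 < k" "k < N" for k
      using that N by (cases k) (auto simp: q_def)
    have P: "schroeder_perm p"
    proof (rule schroeder_permI)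
      show "p \<noteq> []" using lp False by auto
      show "1 \<le> p ! i \<and> p ! i \<le> length p" if "i < length p" for i
        using pn[of i] that lp ge[of i] up[of i] by auto
      show "p ! i \<noteq> p ! j" if "i < j" "j < length p" for i j
        using pn[of i] pn[of j] schroeder_perm_eq[OF s, of i j] that lp m by auto
      fix i j k l assume "i < k" "j < k" "k < l" "l < length p" "p ! k < p ! i" "p ! i < p ! l" "p ! l < p ! j"
      then show False using schroeder_permD[OF s, of i k j l] pn lp m by simp
    qed
    text \<open>The quotient permutation arises from \<open>s\<close> by keeping one representative of the prefix.\<close>
    define h where "h k = (if k = 0 then i0 else m + k)" for k
    have hs: "h k < length s" "h k \<noteq> m" if "k < N" for k using that i0 N by (auto simp: h_def)
    have hm: "h k < h l" if "k < l" for k l using that i0 by (auto simp: h_def)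
    have qh: "q ! k = (if s ! h k \<le> a then s ! h k - 1 else if k = 0 then a else s ! h k - m)" if "k < N" for k
      using that q0 qn[of k] i0a by (auto simp: h_def)
    have hsep: "k \<noteq> 0 \<and> s ! h k \<le> a \<or> k = 0 \<and> s ! h k = Suc a \<or> k \<noteq> 0 \<and> a + m < s ! h k" if "k < N" for k
      using sep'[of "m + k"] that N i0a by (auto simp: h_def)
    have qlt: "q ! k < q ! l \<longleftrightarrow> s ! h k < s ! h l" if "k < N" "l < N" for k l
      using qh[OF that(1)] qh[OF that(2)] hsep[OF that(1)] hsep[OF that(2)] gt1[OF hs[OF that(1)]] gt1[OF hs[OF that(2)]] False
      by auto
    have aN: "a + m \<le> length s" using schroeder_perm_range(2)[OF s, of j0] j0 m by auto
    have Q: "schroeder_perm q"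
    proof (rule schroeder_permI)
      show "q \<noteq> []" by (simp add: q_def)
      show "1 \<le> q ! i \<and> q ! i \<le> length q" if "i < length q" for i
      proof -
        have i: "i < N" using that lq by simp
        show ?thesis using qh[OF i] hsep[OF i] gt1[OF hs[OF i]] schroeder_perm_range(2)[OF s hs(1)[OF i]] a1 aN lq N
          by auto
      qed
      show "q ! i \<noteq> q ! j" if "i < j" "j < length q" for i j
        using qlt[of i j] qlt[of j i] schroeder_perm_eq[OF s, of "h i" "h j"] hs(1)[of i] hs(1)[of j] hm[OF that(1)] that lq
        by (auto simp: nat_neq_iff)
      fix i j k l assume "i < k" "j < k" "k < l" "l < length q" "q ! k < q ! i" "q ! i < q ! l" "q ! l < q ! j"
      then show False using schroeder_permD[OF s, of "h i" "h k" "h j" "h l"] qlt hm hs(1)[of l] lq by simp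
    qed
    have "s = glueP p q"
    proof (rule nth_equalityI)
      show "length s = length (glueP p q)" using glueP_length[OF P Q] lp lq N by simp
      fix i assume "i < length s"
      then have "i < m + N" using N by simp
      then show "s ! i = glueP p q ! i"
      proof (cases rule: glue_index_cases)
        case 1 then show ?thesis using lp pn q0 glueP_nth(1)[of i p q] by simp
      next
        case 2 then show ?thesis using lp m glueP_nth(2)[of p q] by simp
      next
        case (3 k)
        have "s ! (m + k) \<le> a \<or> a + m < s ! (m + k)" "1 < s ! (m + k)"
          using sep'[of "m + k"] gt1[of "m + k"] 3 N by auto
        then show ?thesis using lp lq qn[of k] q0 glueP_nth(3)[of k q p] 3 by auto
      qed
    qed
    then show ?thesis using P Q by blast
  qed
qed

section \<open>Schroeder trees\<close>

datatype stree = Leaf | Unary stree | Node stree stree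

text \<open>This is the length of the encoded words. A unary node counts one for the letter it
  prepends; a binary node adds nothing, because the cut takes the place of the first letter of the
  right word.\<close>

fun leaves :: "stree \<Rightarrow> nat" where
  "leaves Leaf = 1"
| "leaves (Unary t) = Suc (leaves t)"
| "leaves (Node s t) = leaves s + leaves t"

fun seq_of :: "stree \<Rightarrow> nat list" where
  "seq_of Leaf = [0]"
| "seq_of (Unary t) = 0 # seq_of t"
| "seq_of (Node s t) = glueE (seq_of s) (seq_of t)"

fun perm_of :: "stree \<Rightarrow> nat list" where
  "perm_of Leaf = [1]"
| "perm_of (Unary t) = 1 # map Suc (perm_of t)"
| "perm_of (Node s t) = glueP (perm_of s) (perm_of t)"

lemma seq021_seq_of: "seq021 (seq_of t)"
  by (induction t) (auto simp: seq021_Cons0 seq021_glueE, simp add: seq021_def)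

lemma schroeder_perm_perm_of: "schroeder_perm (perm_of t)"
  by (induction t) (auto simp: schroeder_perm_Cons1[simplified] schroeder_perm_glueP, simp add: schroeder_perm_def)

lemma leaves_pos: "0 < leaves t"
  by (induction t) auto

lemma leaves_eq_1: "leaves t = 1 \<longleftrightarrow> t = Leaf"
  using leaves_pos[THEN less_not_refl2] by (cases t) (auto simp: add_is_1)

lemma length_seq_of: "length (seq_of t) = leaves t"
  using seq021_seq_of by (induction t) (auto simp: length_glueE seq021_def)

lemma length_perm_of: "length (perm_of t) = leaves t"
  by (induction t) (auto simp: glueP_length schroeder_perm_perm_of)

text \<open>A node has an entry equal to its positive index at the cut. Behind a prepended 0 every
  entry is below its index.\<close>

lemma seq_of_Unary_neq_Node: "seq_of (Unary s) \<noteq> seq_of (Node a b)"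
proof
  assume eq: "seq_of (Unary s) = seq_of (Node a b)"
  have "Suc (leaves s) = leaves a + leaves b"
    using arg_cong[OF eq, of length] unfolding length_seq_of by simp
  then have less: "leaves a < Suc (leaves s)" using leaves_pos[of b] by simp
  obtain k where k: "leaves a = Suc k" using leaves_pos[of a] by (cases "leaves a") auto
  have "seq_of (Node a b) ! leaves a = leaves a"
    using glueE_nth(2)[of "seq_of a" "seq_of b"] by (simp add: length_seq_of)
  then have "seq_of s ! k = Suc k" unfolding eq[symmetric] k by simp
  then show False using seq021_le[OF seq021_seq_of, of k s] less k by (simp add: length_seq_of)
qed

lemma perm_of_Unary_neq_Node: "perm_of (Unary s) \<noteq> perm_of (Node a b)"
proof
  assume eq: "perm_of (Unary s) = perm_of (Node a b)"
  have "1 < perm_of (Node a b) ! 0"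
    using glueP_gt_1[of "perm_of a" "perm_of b" 0] leaves_pos[of a]
    by (simp add: schroeder_perm_perm_of length_perm_of)
  then show False unfolding eq[symmetric] by simp
qed

lemma inj_seq_of: "seq_of s = seq_of t \<Longrightarrow> s = t"
proof (induction s arbitrary: t)
  case Leaf
  then have "leaves t = 1" using length_seq_of[of t] length_seq_of[of Leaf] by simp
  then show ?case using leaves_eq_1 by auto
next
  case (Unary s)
  then have "leaves t \<noteq> 1" using length_seq_of[of t] length_seq_of[of "Unary s"] leaves_pos[of s] by auto
  then show ?case using Unary seq_of_Unary_neq_Node leaves_eq_1 by (cases t) auto
next
  case (Node a b)
  then have "leaves t \<noteq> 1"
    using length_seq_of[of t] length_seq_of[of "Node a b"] leaves_pos[of a] leaves_pos[of b] by auto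
  then obtain c d where t: "t = Node c d"
    using Node.prems seq_of_Unary_neq_Node leaves_eq_1 by (cases t) metis+
  then have "seq_of a = seq_of c \<and> seq_of b = seq_of d"
    using Node.prems by (intro glueE_inject) (auto simp: seq021_seq_of)
  then show ?case using Node.IH t by simp
qed

lemma inj_perm_of: "perm_of s = perm_of t \<Longrightarrow> s = t"
proof (induction s arbitrary: t)
  case Leaf
  then have "leaves t = 1" using length_perm_of[of t] length_perm_of[of Leaf] by simp
  then show ?case using leaves_eq_1 by auto
next
  case (Unary s)
  then have "leaves t \<noteq> 1" using length_perm_of[of t] length_perm_of[of "Unary s"] leaves_pos[of s] by auto
  then show ?case using Unary perm_of_Unary_neq_Node leaves_eq_1 by (cases t) auto
next
  case (Node a b)
  then have "leaves t \<noteq> 1"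
    using length_perm_of[of t] length_perm_of[of "Node a b"] leaves_pos[of a] leaves_pos[of b] by auto
  then obtain c d where t: "t = Node c d"
    using Node.prems perm_of_Unary_neq_Node leaves_eq_1 by (cases t) metis+
  then have "perm_of a = perm_of c \<and> perm_of b = perm_of d"
    using Node.prems by (intro glueP_inject) (auto simp: schroeder_perm_perm_of)
  then show ?case using Node.IH t by simp
qed

lemma seq_of_surj: "seq021 e \<Longrightarrow> \<exists>t. seq_of t = e"
proof (induction "length e" arbitrary: e rule: less_induct)
  case less
  show ?case
  proof (cases "length e = 1")
    case True
    then show ?thesis using seq021_0[OF less.prems] by (intro exI[of _ Leaf]) (auto simp: length_Suc_conv)
  next
    case False
    then have "2 \<le> length e" using seq021_length[OF less.prems] by linarith
    from seq021_decompose[OF less.prems this] show ?thesis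
    proof (elim disjE exE conjE)
      fix g assume g: "seq021 g" "e = 0 # g"
      then obtain t where "seq_of t = g" using less.hyps[of g] by auto
      then show ?thesis using g by (intro exI[of _ "Unary t"]) simp
    next
      fix a g assume g: "seq021 a" "seq021 g" "e = glueE a g"
      then have "length a < length e" "length g < length e"
        using length_glueE[of g a] seq021_length[OF g(1)] seq021_length[OF g(2)] by (auto simp: length_greater_0_conv)
      then obtain s t where "seq_of s = a" "seq_of t = g" using less.hyps g by meson
      then show ?thesis using g by (intro exI[of _ "Node s t"]) simp
    qed
  qed
qed

lemma perm_of_surj: "schroeder_perm p \<Longrightarrow> \<exists>t. perm_of t = p"
proof (induction "length p" arbitrary: p rule: less_induct)
  case less
  show ?case
  proof (cases "length p = 1")
    case True
    then have "p ! 0 = 1" using schroeder_perm_range[OF less.prems, of 0] by simp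
    then show ?thesis using True by (intro exI[of _ Leaf]) (auto simp: length_Suc_conv)
  next
    case False
    then have "2 \<le> length p" using schroeder_perm_length[OF less.prems] by linarith
    from schroeder_perm_decompose[OF less.prems this] show ?thesis
    proof (elim disjE exE conjE)
      fix g assume g: "schroeder_perm g" "p = 1 # map Suc g"
      then obtain t where "perm_of t = g" using less.hyps[of g] by auto
      then show ?thesis using g by (intro exI[of _ "Unary t"]) simp
    next
      fix a g assume g: "schroeder_perm a" "schroeder_perm g" "p = glueP a g"
      then have "length a < length p" "length g < length p"
        using glueP_length[of a g] schroeder_perm_length[OF g(1)] schroeder_perm_length[OF g(2)] by auto
      then obtain s t where "perm_of s = a" "perm_of t = g" using less.hyps g by meson
      then show ?thesis using g by (intro exI[of _ "Node s t"]) simp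
    qed
  qed
qed

section \<open>Pattern avoidance spelled out by indices\<close>

lemma contains_021:
  "contains w [0, 2, 1] \<longleftrightarrow>
     (\<exists>i j k. i < j \<and> j < k \<and> k < length w \<and> w ! i < w ! k \<and> w ! k < w ! j)"
  (is "?L \<longleftrightarrow> ?R")
proof
  assume ?L
  then obtain "is" where "is": "length is = 3" "sorted_wrt (<) is" "\<forall>x\<in>set is. x < length w"
    "\<forall>a<3. \<forall>b<3. w ! (is ! a) < w ! (is ! b) \<longleftrightarrow> ([0, 2, 1] :: nat list) ! a < [0, 2, 1] ! b"
    unfolding contains_def by (auto simp: numeral_eq_Suc)
  obtain i j k where "is = [i, j, k]" using "is"(1) by (auto simp: length_Suc_conv numeral_eq_Suc)
  with "is"(2-) show ?R
    by (intro exI[of _ i] exI[of _ j] exI[of _ k]) (simp add: numeral_eq_Suc All_less_Suc2)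
next
  assume ?R
  then obtain i j k where "i < j" "j < k" "k < length w" "w ! i < w ! k" "w ! k < w ! j"
    by blast
  then show ?L unfolding contains_def
    by (intro exI[of _ "[i, j, k]"]) (simp add: numeral_eq_Suc All_less_Suc2)
qed

lemma contains_2413:
  "contains w [2, 4, 1, 3] \<longleftrightarrow>
     (\<exists>i j k l. i < j \<and> j < k \<and> k < l \<and> l < length w \<and> w ! k < w ! i \<and> w ! i < w ! l \<and> w ! l < w ! j)"
  (is "?L \<longleftrightarrow> ?R")
proof
  assume ?L
  then obtain "is" where "is": "length is = 4" "sorted_wrt (<) is" "\<forall>x\<in>set is. x < length w"
    "\<forall>a<4. \<forall>b<4. w ! (is ! a) < w ! (is ! b) \<longleftrightarrow> ([2, 4, 1, 3] :: nat list) ! a < [2, 4, 1, 3] ! b"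
    unfolding contains_def by (auto simp: numeral_eq_Suc)
  obtain i j k l where "is = [i, j, k, l]" using "is"(1) by (auto simp: length_Suc_conv numeral_eq_Suc)
  with "is"(2-) show ?R
    by (intro exI[of _ i] exI[of _ j] exI[of _ k] exI[of _ l]) (simp add: numeral_eq_Suc All_less_Suc2)
next
  assume ?R
  then obtain i j k l where "i < j" "j < k" "k < l" "l < length w" "w ! k < w ! i" "w ! i < w ! l" "w ! l < w ! j"
    by blast
  then show ?L unfolding contains_def
    by (intro exI[of _ "[i, j, k, l]"]) (simp add: numeral_eq_Suc All_less_Suc2)
qed

lemma contains_4213:
  "contains w [4, 2, 1, 3] \<longleftrightarrow>
     (\<exists>i j k l. i < j \<and> j < k \<and> k < l \<and> l < length w \<and> w ! k < w ! j \<and> w ! j < w ! l \<and> w ! l < w ! i)"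
  (is "?L \<longleftrightarrow> ?R")
proof
  assume ?L
  then obtain "is" where "is": "length is = 4" "sorted_wrt (<) is" "\<forall>x\<in>set is. x < length w"
    "\<forall>a<4. \<forall>b<4. w ! (is ! a) < w ! (is ! b) \<longleftrightarrow> ([4, 2, 1, 3] :: nat list) ! a < [4, 2, 1, 3] ! b"
    unfolding contains_def by (auto simp: numeral_eq_Suc)
  obtain i j k l where "is = [i, j, k, l]" using "is"(1) by (auto simp: length_Suc_conv numeral_eq_Suc)
  with "is"(2-) show ?R
    by (intro exI[of _ i] exI[of _ j] exI[of _ k] exI[of _ l]) (simp add: numeral_eq_Suc All_less_Suc2)
next
  assume ?R
  then obtain i j k l where "i < j" "j < k" "k < l" "l < length w" "w ! k < w ! j" "w ! j < w ! l" "w ! l < w ! i"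
    by blast
  then show ?L unfolding contains_def
    by (intro exI[of _ "[i, j, k, l]"]) (simp add: numeral_eq_Suc All_less_Suc2)
qed

lemma ball_atLeast1_iff: "(\<forall>i\<in>{1..n}. Q i) \<longleftrightarrow> (\<forall>i<n. Q (Suc i))"
proof -
  have "{1..n} = Suc ` {..<n}" by (simp add: image_Suc_lessThan)
  then show ?thesis by auto
qed

text \<open>Two nonzero entries in decreasing order form 021 together with the leading 0; conversely
  the two larger letters of an occurrence are nonzero.\<close>

lemma seq021_iff:
  assumes "1 \<le> n"
  shows "e \<in> inv_seqs n \<and> avoids e [0, 2, 1] \<longleftrightarrow> seq021 e \<and> length e = n"
proof -
  have inv: "e \<in> inv_seqs n \<longleftrightarrow> length e = n \<and> (\<forall>i<length e. e ! i \<le> i)"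
    unfolding inv_seqs_def letter_def mem_Collect_eq ball_atLeast1_iff by auto
  have "avoids e [0, 2, 1] \<longleftrightarrow> (\<forall>i j. i < j \<longrightarrow> j < length e \<longrightarrow> e ! i \<noteq> 0 \<longrightarrow> e ! j \<noteq> 0 \<longrightarrow> e ! i \<le> e ! j)"
    (is "?L \<longleftrightarrow> ?R") if le: "\<forall>i<length e. e ! i \<le> i" and len: "length e = n"
  proof
    assume L: ?L
    show ?R
    proof (intro allI impI, rule ccontr)
      fix i j assume ij: "i < j" "j < length e" "e ! i \<noteq> 0" "e ! j \<noteq> 0" "\<not> e ! i \<le> e ! j"
      have "e ! 0 = 0" using le[rule_format, of 0] len assms by auto
      then have "0 < i" using ij by (metis neq0_conv)
      then show False using L ij \<open>e ! 0 = 0\<close> unfolding avoids_def contains_021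
        by (metis linorder_not_less neq0_conv)
    qed
  next
    assume R: ?R
    show ?L unfolding avoids_def contains_021
      using R by (metis bot_nat_0.not_eq_extremum linorder_not_less not_less_zero)
  qed
  then show ?thesis using inv assms unfolding seq021_def by auto
qed

lemma schroeder_perm_iff:
  assumes "1 \<le> n"
  shows "p \<in> perms n \<and> avoids p [2, 4, 1, 3] \<and> avoids p [4, 2, 1, 3] \<longleftrightarrow> schroeder_perm p \<and> length p = n"
proof -
  have "avoids p [2, 4, 1, 3] \<and> avoids p [4, 2, 1, 3] \<longleftrightarrow>
    (\<forall>i j k l. i < k \<longrightarrow> j < k \<longrightarrow> k < l \<longrightarrow> l < length p \<longrightarrow>
        \<not> (p ! k < p ! i \<and> p ! i < p ! l \<and> p ! l < p ! j))" (is "?L \<longleftrightarrow> ?R")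
  proof
    assume L: ?L
    show ?R
    proof (intro allI impI notI)
      fix i j k l assume *: "i < k" "j < k" "k < l" "l < length p" "p ! k < p ! i \<and> p ! i < p ! l \<and> p ! l < p ! j"
      consider "i < j" | "j < i" | "i = j" by linarith
      then show False using L * unfolding avoids_def contains_2413 contains_4213
        by cases (blast, blast, auto)
    qed
  next
    assume R: ?R
    then show ?L unfolding avoids_def contains_2413 contains_4213 by (meson less_trans)
  qed
  moreover have "p \<in> perms n \<longleftrightarrow> length p = n \<and> distinct p \<and> set p \<subseteq> {1..length p}"
    using distinct_subset_atLeastAtMost[of p] by (auto simp: perms_def)
  moreover have "p \<noteq> []" if "length p = n" using that assms by auto
  ultimately show ?thesis unfolding schroeder_perm_def by blast
qed

section \<open>Exposed positions\<close>

lemma all_less_split_0: "0 < k \<Longrightarrow> (\<forall>l<k. R l) \<longleftrightarrow> R 0 \<and> (\<forall>l<k. 0 < l \<longrightarrow> R (l::nat))"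
  by (metis neq0_conv)

text \<open>Truncated subtraction does no harm: nonzero entries are at least the offset, and after
  adding the positive \<open>length e\<close> they stay above the zeros.\<close>

lemma glueE_less:
  assumes "seq021 e" "0 < k" "k < length g" "0 < l" "l < length g"
  shows "glueE e g ! (length e + k) < glueE e g ! (length e + l) \<longleftrightarrow> g ! k < g ! l"
    and "glueE e g ! (length e + k) = glueE e g ! (length e + l) \<longleftrightarrow> g ! k = g ! l"
proof -
  have "1 \<le> length e" using seq021_length[OF assms(1)] by simp
  then show "glueE e g ! (length e + k) < glueE e g ! (length e + l) \<longleftrightarrow> g ! k < g ! l"
    and "glueE e g ! (length e + k) = glueE e g ! (length e + l) \<longleftrightarrow> g ! k = g ! l"
    using assms offset_le[of k g] offset_le[of l g] by (auto simp: glueE_nth)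
qed

lemma glueE_cases:
  assumes "0 < k" "k < length g"
  shows "g ! k = 0 \<and> glueE e g ! (length e + k) = 0 \<or>
    g ! k \<noteq> 0 \<and> length e \<le> glueE e g ! (length e + k)"
  using assms by (auto simp: glueE_nth)

text \<open>The cut value recurs exactly at the nonzero entries of \<open>g\<close> equal to the
  offset. These exist when the offset is the least nonzero entry and cannot exist when it is
  0.\<close>

lemma glueE_eq_length:
  assumes "seq021 e" "seq021 g"
  shows "(\<exists>k<length g. 0 < k \<and> glueE e g ! (length e + k) = length e) \<longleftrightarrow> has_ema g"
proof
  assume "\<exists>k<length g. 0 < k \<and> glueE e g ! (length e + k) = length e"
  then obtain k where k: "k < length g" "0 < k" "glueE e g ! (length e + k) = length e" by blast
  then have "g ! k \<noteq> 0" "g ! k = offset g"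
    using glueE_nth(3)[of k g e] seq021_length[OF assms(1)] offset_le[of k g] by (auto split: if_splits)
  then show "has_ema g" using offset_no_ema by metis
next
  assume *: "has_ema g"
  then obtain k where k: "k < length g" "g ! k = offset g" using offset_has_ema(2) by (metis in_set_conv_nth)
  then have "0 < k" using seq021_0[OF assms(2)] offset_has_ema(1)[OF *] by (metis neq0_conv)
  then show "\<exists>k<length g. 0 < k \<and> glueE e g ! (length e + k) = length e"
    using k glueE_nth(3)[of k g e] offset_has_ema(1)[OF *] by auto
qed

text \<open>On 021-avoiding sequences \<open>d\<^sub>i\<close> is simply the prefix maximum. The predicates below use
  positions counted from 0.\<close>

definition pmax :: "nat list \<Rightarrow> nat \<Rightarrow> nat" where
  "pmax e i = Max ((!) e ` {..i})"

definition cov0 :: "nat list \<Rightarrow> nat \<Rightarrow> bool" where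
  "cov0 e i \<longleftrightarrow> e ! i = 0 \<and> (\<exists>a<i. \<exists>b<length e. i < b \<and> e ! a = e ! b \<and> e ! a \<noteq> 0)"

text \<open>The comparison of differences from \<open>EXPO\<close> with the subtracted terms moved
  across; the shift of positions by one cancels.\<close>

definition expo0 :: "nat list \<Rightarrow> nat \<Rightarrow> bool" where
  "expo0 e i \<longleftrightarrow> \<not> cov0 e i \<and> (\<forall>j<length e. i < j \<longrightarrow> i + pmax e j < j + pmax e i)"

lemma pmax_ge: "j \<le> i \<Longrightarrow> e ! j \<le> pmax e i"
  unfolding pmax_def by (intro Max_ge) auto

lemma pmax_in: "\<exists>j\<le>i. e ! j = pmax e i"
proof -
  have "pmax e i \<in> (!) e ` {..i}" unfolding pmax_def by (intro Max_in) auto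
  then show ?thesis by auto
qed

lemma pmax_eqI: "(\<And>j. j \<le> i \<Longrightarrow> e ! j \<le> x) \<Longrightarrow> j \<le> i \<Longrightarrow> e ! j = x \<Longrightarrow> pmax e i = x"
  unfolding pmax_def by (intro Max_eqI) auto

lemma pmax_le:
  assumes "seq021 e" "i < length e"
  shows "pmax e i \<le> i"
proof -
  obtain j where "j \<le> i" "e ! j = pmax e i" using pmax_in by blast
  then show ?thesis using seq021_le[OF assms(1), of j] assms(2) by simp
qed

lemma pmax_mono: "i \<le> j \<Longrightarrow> pmax e i \<le> pmax e j"
  using pmax_in[of i e] pmax_ge[of _ j e] by (metis order_trans)

lemma pmax_Cons0: "pmax (0 # e) (Suc i) = pmax e i"
proof -
  obtain j where j: "j \<le> i" "e ! j = pmax e i" using pmax_in by blast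
  show ?thesis
  proof (rule pmax_eqI)
    show "Suc j \<le> Suc i" "(0 # e) ! Suc j = pmax e i" using j by auto
    show "(0 # e) ! l \<le> pmax e i" if "l \<le> Suc i" for l
      using that pmax_ge[of "l - 1" i e] by (cases l) auto
  qed
qed

text \<open>Past the cut the maximum is at least the cut entry. The witness \<open>w\<close> is the
  cut itself as long as \<open>g\<close> has shown only zeros, and otherwise a place where
  \<open>g\<close> attains its maximum.\<close>

lemma pmax_glueE:
  assumes e: "seq021 e" and g: "seq021 g" and k: "0 < k" "k < length g"
  shows "pmax (glueE e g) (length e + k) =
    (if pmax g k = 0 then length e else pmax g k - offset g + length e)" (is "_ = ?D")
proof -
  let ?m = "length e"
  obtain j0 where j0: "j0 \<le> k" "g ! j0 = pmax g k" using pmax_in by blast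
  define w where "w = (if pmax g k = 0 then ?m else ?m + j0)"
  show ?thesis
  proof (rule pmax_eqI)
    show "w \<le> ?m + k" using j0 by (simp add: w_def)
    have "0 < j0" if "pmax g k \<noteq> 0" using that j0 seq021_0[OF g] by (metis neq0_conv)
    then show "glueE e g ! w = ?D" using j0 k by (auto simp: w_def glueE_nth)
    fix j assume "j \<le> ?m + k"
    then have "j < ?m + Suc k" by simp
    then show "glueE e g ! j \<le> ?D"
    proof (cases rule: glue_index_cases)
      case 1 then show ?thesis using seq021_le[OF e, of j] by (simp add: glueE_nth)
    next
      case 2 then show ?thesis by (simp add: glueE_nth)
    next
      case (3 l)
      then have "g ! l \<le> pmax g k" by (intro pmax_ge) simp
      then show ?thesis using 3 k by (auto simp: glueE_nth diff_le_mono)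
    qed
  qed
qed

text \<open>The last hypothesis excludes zeros that directly follow the cut while the cut value
  recurs later: the cut covers them in the glued word, but nothing covers them in
  \<open>g\<close>.\<close>

lemma cov0_glueE:
  assumes e: "seq021 e" and g: "seq021 g" and k: "0 < k" "k < length g"
    and "\<not> has_ema g \<or> 0 < pmax g k"
  shows "cov0 (glueE e g) (length e + k) \<longleftrightarrow> cov0 g k"
proof
  let ?m = "length e" and ?G = "glueE e g"
  have len: "length ?G = ?m + length g" using k by (intro length_glueE) auto
  assume "cov0 ?G (?m + k)"
  then obtain a b where *: "?G ! (?m + k) = 0" "a < ?m + k" "b < ?m + length g" "?m + k < b"
    "?G ! a = ?G ! b" "?G ! a \<noteq> 0"
    unfolding cov0_def len by blast
  have gk: "g ! k = 0" using glueE_cases[OF k, of e] * seq021_length[OF e] by linarith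
  obtain b' where b': "b = ?m + b'" "k < b'" "b' < length g"
    using that[of "b - ?m"] * by simp
  then have b0: "g ! b' \<noteq> 0" "?m \<le> ?G ! b" using * glueE_cases[of b' g e] by auto
  from \<open>a < ?m + k\<close> show "cov0 g k"
  proof (cases rule: glue_index_cases)
    case 1
    then have "?G ! a < ?m" using seq021_le[OF e, of a] by (simp add: glueE_nth)
    then show ?thesis using b0 * by simp
  next
    case 2
    \<comment> \<open>The cover begins at the cut. The hypothesis yields a nonzero entry of
      \<open>g\<close> before \<open>k\<close>; squeezed between the offset and
      \<open>g ! b'\<close>, it equals both and covers \<open>k\<close> inside
      \<open>g\<close>.\<close>
    then have m: "?G ! (?m + b') = ?m" using * b' glueE_nth(2)[of e g] by simp
    then have "has_ema g" using glueE_eq_length[OF e g] b' by (metis gr_implies_not0 neq0_conv)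
    moreover have "g ! b' = offset g" using m b' b0 k glueE_nth(3)[of b' g e] offset_le[of b' g] by auto
    moreover obtain a' where a': "a' \<le> k" "g ! a' = pmax g k" using pmax_in by blast
    ultimately have "0 < pmax g k" "a' < k" using assms(5) gk by (auto simp: le_less)
    moreover have "g ! a' \<le> g ! b'" using seq021_mono[OF g, of a' b'] a' b' b0 \<open>0 < pmax g k\<close> by simp
    moreover have "offset g \<le> g ! a'" using offset_le[of a' g] a' k \<open>0 < pmax g k\<close> by simp
    ultimately have "g ! a' = g ! b'" using \<open>g ! b' = offset g\<close> by simp
    then show ?thesis using gk b' b0 \<open>a' < k\<close> unfolding cov0_def by metis
  next
    case (3 a')
    then have "g ! a' = g ! b'" using glueE_less(2)[OF e, of a' g b'] b' k * by simp
    then show ?thesis using gk b' b0 3 unfolding cov0_def by metis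
  qed
next
  let ?m = "length e" and ?G = "glueE e g"
  have len: "length ?G = ?m + length g" using k by (intro length_glueE) auto
  assume "cov0 g k"
  then obtain a b where *: "g ! k = 0" "a < k" "b < length g" "k < b" "g ! a = g ! b" "g ! a \<noteq> 0"
    unfolding cov0_def by blast
  have "0 < a" using * seq021_0[OF g] by (metis neq0_conv)
  then have "?G ! (?m + a) = ?G ! (?m + b)" "?G ! (?m + a) \<noteq> 0" "?G ! (?m + k) = 0"
    using * k seq021_length[OF e] by (auto simp: glueE_nth)
  then show "cov0 ?G (?m + k)" unfolding cov0_def len using * by (metis add_less_cancel_left)
qed

text \<open>Under the last hypothesis of \<open>cov0_glueE\<close> all prefix maxima from
  \<open>k\<close> on move by the same amount. Otherwise both sides are false: the glued word covers
  the position, and in \<open>g\<close> a later entry \<open>g ! q = q\<close> breaks the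
  inequality. This is where excluding covered positions matters.\<close>

lemma expo0_glueE:
  assumes e: "seq021 e" and g: "seq021 g" and k: "0 < k" "k < length g"
  shows "expo0 (glueE e g) (length e + k) \<longleftrightarrow> expo0 g k"
proof -
  let ?m = "length e" and ?G = "glueE e g"
  have N: "0 < length g" using k by simp
  have len: "length ?G = ?m + length g" using N by (intro length_glueE) auto
  show ?thesis
  proof (cases "\<not> has_ema g \<or> 0 < pmax g k")
    case True
    have ge: "offset g \<le> pmax g l" if "k \<le> l" "l < length g" for l
    proof (cases "has_ema g")
      case True
      then have "0 < pmax g l" using pmax_mono[OF that(1), of g] \<open>\<not> has_ema g \<or> 0 < pmax g k\<close> by simp
      moreover obtain j where "j \<le> l" "g ! j = pmax g l" using pmax_in by blast
      ultimately show ?thesis using offset_le[of j g] that by simp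
    qed (simp add: offset_no_ema)
    have "?m + k + pmax ?G (?m + l) < ?m + l + pmax ?G (?m + k) \<longleftrightarrow> k + pmax g l < l + pmax g k"
      if "k < l" "l < length g" for l
    proof (cases "has_ema g")
      case T: True
      then have "0 < pmax g k" "0 < pmax g l" using True pmax_mono[of k l g] that by auto
      then show ?thesis using pmax_glueE[OF e g k] pmax_glueE[OF e g, of l] ge[of k] ge[of l] that k by auto
    next
      case False
      then show ?thesis using pmax_glueE[OF e g k] pmax_glueE[OF e g, of l] that k offset_no_ema by auto
    qed
    then show ?thesis unfolding expo0_def len all_glue_index[OF N] cov0_glueE[OF e g k True]
      using k by auto
  next
    case False
    then obtain q where q: "q < length g" "0 < q" "g ! q = q" "pmax g k = 0" by (auto simp: has_ema_def)
    have "k < q"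
    proof (rule ccontr)
      assume "\<not> k < q"
      then have "q \<le> pmax g k" using pmax_ge[of q k g] q by simp
      then show False using q by simp
    qed
    have "\<not> expo0 g k" using q \<open>k < q\<close> pmax_ge[of q q g] unfolding expo0_def by (metis add_0_right le_add2 le_trans linorder_not_less order_refl)
    moreover
    obtain b where b: "b < length g" "0 < b" "?G ! (?m + b) = ?m"
      using False glueE_eq_length[OF e g] by blast
    have z: "g ! l = 0" if "l \<le> k" for l using pmax_ge[OF that, of g] q by simp
    have "k < b" using b z[of b] glueE_nth(3)[of b g e] seq021_length[OF e] by (cases "k < b") auto
    have "cov0 ?G (?m + k)" unfolding cov0_def len
      using z[of k] k b \<open>k < b\<close> seq021_length[OF e] glueE_nth(3)[OF k, of e] glueE_nth(2)[of e g]
      by (intro conjI exI[of _ ?m] exI[of _ "?m + b"]) auto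
    ultimately show ?thesis unfolding expo0_def by blast
  qed
qed

section \<open>Entries and comparisons in the two words of a node\<close>

context
  fixes s t :: stree
begin

private lemmas sq = seq021_seq_of and sp = schroeder_perm_perm_of

lemma seq_Node:
  "i < leaves s \<Longrightarrow> seq_of (Node s t) ! i = seq_of s ! i"
  "seq_of (Node s t) ! leaves s = leaves s"
  "0 < k \<Longrightarrow> k < leaves t \<Longrightarrow> seq_of (Node s t) ! (leaves s + k) = 0 \<longleftrightarrow> seq_of t ! k = 0"
  "0 < k \<Longrightarrow> k < leaves t \<Longrightarrow> seq_of (Node s t) ! (leaves s + k) = 0 \<or> leaves s \<le> seq_of (Node s t) ! (leaves s + k)"
  "0 < k \<Longrightarrow> k < leaves t \<Longrightarrow> seq_of (Node s t) ! (leaves s + k) < leaves s + k"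
  "0 < k \<Longrightarrow> k < leaves t \<Longrightarrow> 0 < l \<Longrightarrow> l < leaves t \<Longrightarrow>
     seq_of (Node s t) ! (leaves s + k) < seq_of (Node s t) ! (leaves s + l) \<longleftrightarrow> seq_of t ! k < seq_of t ! l"
  "0 < k \<Longrightarrow> k < leaves t \<Longrightarrow> 0 < l \<Longrightarrow> l < leaves t \<Longrightarrow>
     seq_of (Node s t) ! (leaves s + k) = seq_of (Node s t) ! (leaves s + l) \<longleftrightarrow> seq_of t ! k = seq_of t ! l"
  using glueE_nth(1)[of i "seq_of s" "seq_of t"] glueE_nth(2)[of "seq_of s" "seq_of t"] glueE_cases[of k "seq_of t" "seq_of s"]
    glueE_not_ema[OF sq, of k t "seq_of s"] glueE_less[OF sq, of k "seq_of t" l s] leaves_pos[of s]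
  by (auto simp: length_seq_of)

lemma perm_Node:
  "i < leaves s \<Longrightarrow> j < leaves s \<Longrightarrow> perm_of (Node s t) ! i < perm_of (Node s t) ! j \<longleftrightarrow> perm_of s ! i < perm_of s ! j"
  "perm_of (Node s t) ! leaves s = Suc 0"
  "i < leaves s \<Longrightarrow> Suc 0 < perm_of (Node s t) ! i"
  "0 < k \<Longrightarrow> k < leaves t \<Longrightarrow> Suc 0 < perm_of (Node s t) ! (leaves s + k)"
  "i < leaves s \<Longrightarrow> 0 < k \<Longrightarrow> k < leaves t \<Longrightarrow>
     perm_of (Node s t) ! i < perm_of (Node s t) ! (leaves s + k) \<longleftrightarrow> perm_of t ! 0 < perm_of t ! k"
  "i < leaves s \<Longrightarrow> 0 < k \<Longrightarrow> k < leaves t \<Longrightarrow>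
     perm_of (Node s t) ! (leaves s + k) < perm_of (Node s t) ! i \<longleftrightarrow> perm_of t ! k < perm_of t ! 0"
  "0 < k \<Longrightarrow> k < leaves t \<Longrightarrow> 0 < l \<Longrightarrow> l < leaves t \<Longrightarrow>
     perm_of (Node s t) ! (leaves s + k) < perm_of (Node s t) ! (leaves s + l) \<longleftrightarrow> perm_of t ! k < perm_of t ! l"
  using glueP_nth(1)[of i "perm_of s" "perm_of t"] glueP_nth(1)[of j "perm_of s" "perm_of t"]
    glueP_nth(2)[of "perm_of s" "perm_of t"] glueP_gt_1[OF sp sp, of i s t]
    glueP_gt_1[OF sp sp, of "leaves s + k" s t] glueP_less_prefix[OF sp sp, of i s k t]
    glueP_less_suffix[OF sp sp, of k t l s]
  by (auto simp: length_perm_of)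

end

section \<open>Equality of the statistics\<close>

lemma perm_of_range:
  assumes "i < leaves t"
  shows "1 \<le> perm_of t ! i" "perm_of t ! i \<le> leaves t"
  using schroeder_perm_range[OF schroeder_perm_perm_of, of i t] assms by (auto simp: length_perm_of)

lemma perm_of_eq: "i < leaves t \<Longrightarrow> j < leaves t \<Longrightarrow> perm_of t ! i = perm_of t ! j \<longleftrightarrow> i = j"
  using schroeder_perm_eq[OF schroeder_perm_perm_of] by (simp add: length_perm_of)

lemma seq_of_le: "i < leaves t \<Longrightarrow> seq_of t ! i \<le> i"
  using seq021_le[OF seq021_seq_of] by (simp add: length_seq_of)

lemma seq_of_0: "seq_of t ! 0 = 0"
  using seq021_0[OF seq021_seq_of] .

text \<open>Against a letter after the cut the whole prefix acts as the single letter
  \<open>perm_of t ! 0\<close>, and the letter 1 is no obstacle. At the cut both conditions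
  fail.\<close>

lemma zero_iff_lma:
  "i < leaves t \<Longrightarrow> seq_of t ! i = 0 \<longleftrightarrow> (\<forall>j<i. perm_of t ! j < perm_of t ! i)"
proof (induction t arbitrary: i)
  case (Unary t)
  then show ?case using perm_of_range(1)[of "i - 1" t] by (cases i) (auto simp: All_less_Suc2 length_perm_of)
next
  case (Node s t)
  from Node.prems have "i < leaves s + leaves t" by simp
  then show ?case
  proof (cases rule: glue_index_cases)
    case 1
    then show ?thesis using Node.IH(1)[of i] by (simp add: seq_Node perm_Node del: seq_of.simps perm_of.simps)
  next
    case 2
    have "\<not> perm_of (Node s t) ! 0 < perm_of (Node s t) ! leaves s"
      using perm_Node(3)[of 0 s t] leaves_pos[of s] by (simp add: perm_Node(2) del: perm_of.simps)
    then show ?thesis using 2 leaves_pos[of s] by (auto simp: seq_Node(2) simp del: seq_of.simps perm_of.simps)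
  next
    case (3 k)
    have "(\<forall>j<leaves s + k. perm_of (Node s t) ! j < perm_of (Node s t) ! (leaves s + k)) \<longleftrightarrow>
      perm_of t ! 0 < perm_of t ! k \<and> (\<forall>l<k. 0 < l \<longrightarrow> perm_of t ! l < perm_of t ! k)"
      unfolding all_glue_index[OF 3(1)] using 3 leaves_pos[of s]
      by (auto simp: perm_Node simp del: perm_of.simps)
    also have "\<dots> \<longleftrightarrow> (\<forall>l<k. perm_of t ! l < perm_of t ! k)"
      by (rule all_less_split_0[OF 3(1), symmetric])
    finally show ?thesis using Node.IH(2)[of k] 3 by (simp add: seq_Node del: seq_of.simps perm_of.simps)
  qed
qed simp

text \<open>After the cut neither side can hold: the letter 1 has already appeared, and entries
  there stay below their index.\<close>

lemma ema_iff_lmi: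
  "i < leaves t \<Longrightarrow> seq_of t ! i = i \<longleftrightarrow> (\<forall>j<i. perm_of t ! i < perm_of t ! j)"
proof (induction t arbitrary: i)
  case (Unary t)
  then show ?case using seq_of_le[of "i - 1" t] by (cases i) (auto simp: All_less_Suc2 length_perm_of)
next
  case (Node s t)
  from Node.prems have "i < leaves s + leaves t" by simp
  then show ?case
  proof (cases rule: glue_index_cases)
    case 1
    then show ?thesis using Node.IH(1)[of i] by (simp add: seq_Node perm_Node del: seq_of.simps perm_of.simps)
  next
    case 2
    then show ?thesis by (auto simp: seq_Node perm_Node simp del: seq_of.simps perm_of.simps)
  next
    case (3 k)
    have "\<not> perm_of (Node s t) ! (leaves s + k) < perm_of (Node s t) ! leaves s"
      using 3 perm_Node(4)[of k t s] by (simp add: perm_Node(2) del: perm_of.simps)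
    then show ?thesis using 3 seq_Node(5)[of k t s]
      by (auto intro!: exI[of _ "leaves s"] simp del: seq_of.simps perm_of.simps)
  qed
qed simp

lemma rmi_iff_rma:
  "i < leaves t \<Longrightarrow> (\<forall>j<leaves t. i < j \<longrightarrow> seq_of t ! i < seq_of t ! j) \<longleftrightarrow>
     (\<forall>j<leaves t. i < j \<longrightarrow> perm_of t ! j < perm_of t ! i)"
proof (induction t arbitrary: i)
  case (Unary t)
  show ?case
  proof (cases i)
    case 0
    have "\<not> seq_of (Unary t) ! 0 < seq_of (Unary t) ! 1" "\<not> perm_of (Unary t) ! 1 < perm_of (Unary t) ! 0"
      using seq_of_0 perm_of_range(1)[of 0 t] leaves_pos[of t] length_perm_of[of t] by auto
    then show ?thesis using 0 leaves_pos[of t] by (auto simp del: seq_of.simps perm_of.simps intro!: exI[of _ 1])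
  next
    case (Suc k)
    then show ?thesis using Unary by (simp add: All_less_Suc2 length_perm_of)
  qed
next
  case (Node s t)
  have N: "0 < leaves t" by (rule leaves_pos)
  from Node.prems have "i < leaves s + leaves t" by simp
  then show ?case
  proof (cases rule: glue_index_cases)
    case 1
    \<comment> \<open>A prefix entry is below every nonzero entry after the cut, so only zeros there
      matter. Their absence is the condition at index 0 of \<open>t\<close>, whence
      \<open>Node.IH(2)[of 0]\<close>; for permutations it says that the prefix lies above
      everything after the cut.\<close>
    have "seq_of s ! i < leaves s" using seq_of_le[OF 1] 1 by simp
    then have "seq_of s ! i < seq_of (Node s t) ! (leaves s + k) \<longleftrightarrow> seq_of t ! 0 < seq_of t ! k"
      if "k < leaves t" "0 < k" for k
      using seq_Node(3,4)[OF that(2,1), of s] seq_of_0[of t] by (auto simp del: seq_of.simps)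
    then show ?thesis using Node.IH(1)[of i] Node.IH(2)[of 0] 1 N \<open>seq_of s ! i < leaves s\<close>
      unfolding leaves.simps all_glue_index[OF N]
      by (auto simp: seq_Node(1,2) perm_Node(1,2,3,6) simp del: seq_of.simps perm_of.simps)
  next
    case 2
    \<comment> \<open>Both conditions force the cut to be the last position: the next entry is below
      its index, thus at most \<open>leaves s\<close>, and the next letter exceeds 1.\<close>
    have "leaves t = 1" if "\<forall>k<leaves t. 0 < k \<longrightarrow> leaves s < seq_of (Node s t) ! (leaves s + k)"
      using that[rule_format, of 1] seq_Node(5)[of 1 t s] N by (cases "leaves t = 1") auto
    moreover have "leaves t = 1" if "\<forall>k<leaves t. 0 < k \<longrightarrow> perm_of (Node s t) ! (leaves s + k) < 1"
      using that[rule_format, of 1] perm_Node(4)[of 1 t s] N by (cases "leaves t = 1") auto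
    ultimately show ?thesis using 2 unfolding leaves.simps all_glue_index[OF N]
      by (auto simp: seq_Node(2) perm_Node(2) simp del: seq_of.simps perm_of.simps)
  next
    case (3 k)
    then show ?thesis using Node.IH(2)[of k] unfolding leaves.simps all_glue_index[OF N]
      by (auto simp: seq_Node(6) perm_Node(7) simp del: seq_of.simps perm_of.simps)
  qed
qed simp

lemma asc_iff_des:
  "Suc i < leaves t \<Longrightarrow> seq_of t ! i < seq_of t ! Suc i \<longleftrightarrow> perm_of t ! Suc i < perm_of t ! i"
proof (induction t arbitrary: i)
  case (Unary t)
  then show ?case using seq_of_0[of t] perm_of_range(1)[of 0 t] length_perm_of[of t] leaves_pos[of t]
    by (cases i) auto
next
  case (Node s t)
  from Node.prems have "i < leaves s + leaves t" by simp
  then show ?case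
  proof (cases rule: glue_index_cases)
    case 1
    show ?thesis
    proof (cases "Suc i = leaves s")
      case True
      then show ?thesis using 1 seq_of_le[OF 1] perm_Node(2)[of s t] perm_Node(3)[OF 1, of t] seq_Node(1)[OF 1, of t] seq_Node(2)[of s t]
        by (simp del: seq_of.simps perm_of.simps)
    next
      case False
      then show ?thesis using 1 Node.IH(1)[of i] by (simp add: seq_Node perm_Node del: seq_of.simps perm_of.simps)
    qed
  next
    case 2
    then show ?thesis using Node.prems seq_Node(5)[of 1 t s] perm_Node(4)[of 1 t s]
      by (auto simp: seq_Node(2) perm_Node(2) simp del: seq_of.simps perm_of.simps)
  next
    case (3 k)
    then show ?thesis using Node.IH(2)[of k] Node.prems seq_Node(6)[of k t "Suc k" s] perm_Node(7)[of "Suc k" t k s]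
      by (simp del: seq_of.simps perm_of.simps)
  qed
qed simp

text \<open>By \<open>ema_iff_lmi\<close>, since a permutation has a left-to-right minimum beyond
  its first letter unless it starts with 1. This turns the case distinction in \<open>offset\<close>
  into a property of the permutation.\<close>

lemma has_ema_seq_of: "has_ema (seq_of t) \<longleftrightarrow> perm_of t ! 0 \<noteq> 1"
proof
  assume "has_ema (seq_of t)"
  then obtain k where k: "k < leaves t" "0 < k" "seq_of t ! k = k" by (auto simp: has_ema_def length_seq_of)
  then have "perm_of t ! k < perm_of t ! 0" using ema_iff_lmi[of k t] by simp
  then show "perm_of t ! 0 \<noteq> 1" using perm_of_range(1)[of k t] k by simp
next
  assume *: "perm_of t ! 0 \<noteq> 1"
  obtain k where k: "k < leaves t" "perm_of t ! k = 1"
    using schroeder_perm_1[OF schroeder_perm_perm_of, of t] by (auto simp: length_perm_of)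
  then have k0: "0 < k" using * by (cases k) auto
  have "perm_of t ! k < perm_of t ! j" if "j < k" for j
    using perm_of_range(1)[of j t] perm_of_eq[of j t k] k that by auto
  then have "seq_of t ! k = k" using ema_iff_lmi[OF k(1)] by blast
  then show "has_ema (seq_of t)" using k k0 by (auto simp: has_ema_def length_seq_of)
qed

text \<open>Only the contracted letter needs care: if it is the successor of
  \<open>perm_of t ! k\<close>, then in the glued word the successor is the least prefix letter,
  which stands where \<open>perm_of s\<close> has its 1.\<close>

lemma vid_Node_suffix:
  assumes k: "0 < k" "k < leaves t"
  shows "(\<exists>j<leaves s + k. perm_of (Node s t) ! j = perm_of (Node s t) ! (leaves s + k) + 1) \<longleftrightarrow>
    (\<exists>j<k. perm_of t ! j = perm_of t ! k + 1)"
proof -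
  let ?G = "perm_of (Node s t)" and ?m = "leaves s" and ?a = "perm_of t ! 0" and ?b = "perm_of t ! k"
  have G: "?G ! j = perm_of s ! j + ?a" if "j < ?m" for j
    using glueP_nth(1)[of j "perm_of s" "perm_of t"] that by (simp add: length_perm_of)
  have GS: "?G ! (?m + l) = (if perm_of t ! l < ?a then perm_of t ! l + 1 else perm_of t ! l + ?m)"
    if "0 < l" "l < leaves t" for l
    using glueP_nth(3)[of l "perm_of t" "perm_of s"] that by (simp add: length_perm_of)
  have ne: "perm_of t ! l \<noteq> ?a" if "0 < l" "l < leaves t" for l
    using perm_of_eq[of l t 0] that by simp
  have m1: "1 \<le> ?m" using leaves_pos[of s] by simp
  have pre: "(\<exists>j<?m. ?G ! j = ?G ! (?m + k) + 1) \<longleftrightarrow> ?a = ?b + 1"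
  proof
    assume "\<exists>j<?m. ?G ! j = ?G ! (?m + k) + 1"
    then obtain j where "j < ?m" "perm_of s ! j + ?a = ?G ! (?m + k) + 1" using G by metis
    then show "?a = ?b + 1" using perm_of_range[of j s] GS[OF k] ne[OF k] by (auto split: if_splits)
  next
    assume "?a = ?b + 1"
    moreover obtain j where "j < ?m" "perm_of s ! j = 1"
      using schroeder_perm_1[OF schroeder_perm_perm_of, of s] by (auto simp: length_perm_of)
    ultimately show "\<exists>j<?m. ?G ! j = ?G ! (?m + k) + 1"
      using G[of j] GS[OF k] by (intro exI[of _ j]) (simp del: perm_of.simps)
  qed
  have suf: "?G ! (?m + l) = ?G ! (?m + k) + 1 \<longleftrightarrow> perm_of t ! l = ?b + 1" if "0 < l" "l < k" for l
    using GS[OF k] GS[of l] ne[OF k] ne[of l] that k m1 by (auto simp del: perm_of.simps)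
  have "?G ! ?m \<noteq> ?G ! (?m + k) + 1" using perm_Node(2)[of s t] perm_Node(4)[OF k, of s] by simp
  then have "(\<exists>j<?m + k. ?G ! j = ?G ! (?m + k) + 1) \<longleftrightarrow> ?a = ?b + 1 \<or> (\<exists>l<k. 0 < l \<and> perm_of t ! l = ?b + 1)"
    unfolding ex_glue_index[OF k(1)] pre using suf by blast
  also have "\<dots> \<longleftrightarrow> (\<exists>j<k. perm_of t ! j = ?b + 1)" using k by (metis neq0_conv)
  finally show ?thesis .
qed

text \<open>The decisive position is the cut: \<open>leaves s\<close> fails to recur exactly when
  \<open>perm_of t\<close> starts with 1, which is exactly when the successor 2 of the cut letter
  lies in the prefix.\<close>

lemma dist_iff_vid:
  "i < leaves t \<Longrightarrow> seq_of t ! i \<noteq> 0 \<and> (\<forall>j<leaves t. i < j \<longrightarrow> seq_of t ! i \<noteq> seq_of t ! j) \<longleftrightarrow>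
     (\<exists>j<i. perm_of t ! j = perm_of t ! i + 1)"
proof (induction t arbitrary: i)
  case (Unary t)
  then show ?case using perm_of_range(1)[of "i - 1" t]
    by (cases i) (auto simp: All_less_Suc2 Ex_less_Suc2 length_perm_of)
next
  case (Node s t)
  have N: "0 < leaves t" by (rule leaves_pos)
  from Node.prems have "i < leaves s + leaves t" by simp
  then show ?case
  proof (cases rule: glue_index_cases)
    case 1
    have lt: "seq_of s ! i < leaves s" using seq_of_le[OF 1] 1 by simp
    then have "seq_of s ! i \<noteq> 0 \<longrightarrow> seq_of s ! i \<noteq> seq_of (Node s t) ! (leaves s + k)"
      if "k < leaves t" "0 < k" for k
      using seq_Node(4)[OF that(2,1), of s] by (auto simp del: seq_of.simps)
    then have "seq_of (Node s t) ! i \<noteq> 0 \<and> (\<forall>j<leaves (Node s t). i < j \<longrightarrow> seq_of (Node s t) ! i \<noteq> seq_of (Node s t) ! j)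
      \<longleftrightarrow> seq_of s ! i \<noteq> 0 \<and> (\<forall>j<leaves s. i < j \<longrightarrow> seq_of s ! i \<noteq> seq_of s ! j)"
      using 1 lt unfolding leaves.simps all_glue_index[OF N] by (auto simp: seq_Node(1,2) simp del: seq_of.simps)
    moreover have "perm_of (Node s t) ! j = perm_of s ! j + perm_of t ! 0" if "j \<le> i" for j
      using glueP_nth(1)[of j "perm_of s" "perm_of t"] that 1 by (simp add: length_perm_of)
    then have "(\<exists>j<i. perm_of (Node s t) ! j = perm_of (Node s t) ! i + 1) \<longleftrightarrow>
        (\<exists>j<i. perm_of s ! j = perm_of s ! i + 1)"
      by (intro ex_cong1 conj_cong) (auto simp del: perm_of.simps)
    ultimately show ?thesis using Node.IH(1)[OF 1] by blast
  next
    case 2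
    have "(\<forall>j<leaves s + leaves t. leaves s < j \<longrightarrow> leaves s \<noteq> seq_of (Node s t) ! j) \<longleftrightarrow> \<not> has_ema (seq_of t)"
      using glueE_eq_length[OF seq021_seq_of seq021_seq_of, of t s]
      unfolding all_glue_index[OF N] length_seq_of by auto
    moreover have "(\<exists>j<leaves s. perm_of (Node s t) ! j = 2) \<longleftrightarrow> perm_of t ! 0 = 1"
    proof -
      have G: "perm_of (Node s t) ! j = perm_of s ! j + perm_of t ! 0" if "j < leaves s" for j
        using glueP_nth(1)[of j "perm_of s" "perm_of t"] that by (simp add: length_perm_of)
      obtain j where "j < leaves s" "perm_of s ! j = 1"
        using schroeder_perm_1[OF schroeder_perm_perm_of, of s] by (auto simp: length_perm_of)
      moreover have "perm_of t ! 0 = 1" if "j < leaves s" "perm_of s ! j + perm_of t ! 0 = 2" for j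
        using perm_of_range(1)[OF that(1)] perm_of_range(1)[OF N] that(2) by linarith
      ultimately show ?thesis using G by (metis one_add_one)
    qed
    ultimately show ?thesis using 2 leaves_pos[of s] has_ema_seq_of[of t]
      by (simp add: seq_Node(2) perm_Node(2) numeral_2_eq_2 del: seq_of.simps perm_of.simps)
  next
    case (3 k)
    have "seq_of (Node s t) ! i \<noteq> 0 \<and> (\<forall>j<leaves (Node s t). i < j \<longrightarrow> seq_of (Node s t) ! i \<noteq> seq_of (Node s t) ! j)
      \<longleftrightarrow> seq_of t ! k \<noteq> 0 \<and> (\<forall>j<leaves t. k < j \<longrightarrow> seq_of t ! k \<noteq> seq_of t ! j)"
      using 3 unfolding leaves.simps all_glue_index[OF N] by (auto simp: seq_Node(3,7) simp del: seq_of.simps)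
    then show ?thesis using Node.IH(2)[OF 3(2)] vid_Node_suffix[OF 3(1,2), of s] 3(3) by simp
  qed
qed simp

text \<open>At the cut the prefix maximum equals the index, which excludes all earlier positions
  just as the letter 1 does. Later maxima stay below their index, so the cut is exposed; positions
  after it are handled by \<open>expo0_glueE\<close>.\<close>

lemma expo_iff_rmi:
  "i < leaves t \<Longrightarrow> expo0 (seq_of t) i \<longleftrightarrow> (\<forall>j<leaves t. i < j \<longrightarrow> perm_of t ! i < perm_of t ! j)"
proof (induction t arbitrary: i)
  case Leaf
  then show ?case by (simp add: expo0_def cov0_def)
next
  case (Unary t)
  show ?case
  proof (cases i)
    case 0
    have "pmax (seq_of (Unary t)) j < j" if "0 < j" "j \<le> leaves t" for j
      using that pmax_le[OF seq021_seq_of, of "j - 1" t] by (cases j) (auto simp: pmax_Cons0 length_seq_of)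
    then have "expo0 (seq_of (Unary t)) 0"
      unfolding expo0_def cov0_def by (auto simp: length_seq_of trans_less_add1 simp del: seq_of.simps)
    moreover have "perm_of (Unary t) ! 0 < perm_of (Unary t) ! j" if "0 < j" "j < leaves (Unary t)" for j
      using that perm_of_range(1)[of "j - 1" t] by (cases j) (auto simp: length_perm_of)
    ultimately show ?thesis using 0 by blast
  next
    case (Suc k)
    have "expo0 (0 # seq_of t) (Suc k) \<longleftrightarrow> expo0 (seq_of t) k"
      unfolding expo0_def cov0_def by (auto simp: pmax_Cons0 All_less_Suc2 Ex_less_Suc2)
    then show ?thesis using Unary Suc by (simp add: All_less_Suc2 length_perm_of)
  qed
next
  case (Node s t)
  have N: "0 < leaves t" by (rule leaves_pos)
  let ?G = "seq_of (Node s t)" and ?m = "leaves s"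
  have lenG: "length ?G = ?m + leaves t" using length_seq_of[of "Node s t"] by simp
  have pm: "pmax ?G ?m = ?m"
  proof (rule pmax_eqI[of _ _ _ ?m])
    show "?G ! j \<le> ?m" if "j \<le> ?m" for j
      using seq_of_le[of j "Node s t"] that N by (simp del: seq_of.simps)
  qed (simp_all add: seq_Node(2) del: seq_of.simps)
  from Node.prems have i: "i < ?m + leaves t" by simp
  then show ?case
  proof (cases rule: glue_index_cases)
    case 1
    have "pmax ?G i \<le> i" using pmax_le[OF seq021_seq_of, of i "Node s t"] i lenG by simp
    then have "\<not> expo0 ?G i" using 1 pm lenG N unfolding expo0_def by (auto intro!: exI[of _ ?m] simp del: seq_of.simps)
    moreover have "\<not> perm_of (Node s t) ! i < perm_of (Node s t) ! ?m"
      using perm_Node(2)[of s t] perm_Node(3)[OF 1, of t] by simp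
    ultimately show ?thesis using 1 N
      by (auto intro!: exI[of _ ?m] simp del: seq_of.simps perm_of.simps)
  next
    case 2
    have "pmax ?G j < j" if j: "?m < j" "j < ?m + leaves t" for j
    proof -
      obtain l where l: "l \<le> j" "?G ! l = pmax ?G j" using pmax_in by blast
      show ?thesis
      proof (cases "l = j")
        case True
        then show ?thesis using l j seq_Node(5)[of "j - ?m" t s] by simp
      next
        case False
        then show ?thesis using l j seq_of_le[of l "Node s t"] by simp
      qed
    qed
    then have "expo0 ?G i" using 2 pm seq_Node(2)[of s t] leaves_pos[of s]
      unfolding expo0_def cov0_def lenG by (auto simp del: seq_of.simps)
    moreover have "\<forall>j<leaves (Node s t). i < j \<longrightarrow> perm_of (Node s t) ! i < perm_of (Node s t) ! j"
      using 2 unfolding leaves.simps all_glue_index[OF N]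
      by (auto simp: perm_Node(2) perm_Node(4) simp del: perm_of.simps)
    ultimately show ?thesis by simp
  next
    case (3 k)
    have "expo0 ?G i \<longleftrightarrow> expo0 (seq_of t) k"
      using expo0_glueE[OF seq021_seq_of seq021_seq_of 3(1), of t s] 3 by (simp add: length_seq_of)
    then show ?thesis using Node.IH(2)[of k] 3 unfolding leaves.simps all_glue_index[OF N]
      by (auto simp: perm_Node(7) simp del: seq_of.simps perm_of.simps)
  qed
qed

section \<open>From zero-based indices to the sets of positions\<close>

lemma position_set_eqI:
  assumes "A \<subseteq> {1..n}" "B \<subseteq> {1..n}" "\<And>i. i < n \<Longrightarrow> Suc i \<in> A \<longleftrightarrow> Suc i \<in> B"
  shows "A = B"
proof (rule set_eqI)
  fix x
  show "x \<in> A \<longleftrightarrow> x \<in> B"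
  proof (cases "x \<in> {1..n}")
    case True
    then obtain i where "x = Suc i" "i < n" by (cases x) auto
    then show ?thesis using assms(3) by simp
  next
    case False
    then show ?thesis using assms(1,2) by blast
  qed
qed

lemma ball_before_iff: "(\<forall>j\<in>{1..<Suc i}. Q j) \<longleftrightarrow> (\<forall>j<i. Q (Suc j))"
  unfolding atLeastLessThanSuc_atLeastAtMost by (rule ball_atLeast1_iff)

lemma ball_after_iff: "(\<forall>j\<in>{Suc i<..n}. Q j) \<longleftrightarrow> (\<forall>j<n. i < j \<longrightarrow> Q (Suc j))"
proof -
  have "{Suc i<..n} = {j \<in> {1..n}. Suc i < j}" by auto
  then have "(\<forall>j\<in>{Suc i<..n}. Q j) \<longleftrightarrow> (\<forall>j\<in>{1..n}. Suc i < j \<longrightarrow> Q j)" by auto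
  then show ?thesis unfolding ball_atLeast1_iff by simp
qed

text \<open>A nonzero entry is at least every earlier entry, so it is itself the prefix maximum and
  the two clauses of \<open>dval\<close> agree.\<close>

lemma dval_seq021:
  assumes "seq021 e" "i < length e"
  shows "dval e (Suc i) = pmax e i"
proof (cases "e ! i = 0")
  case True
  have "letter e ` {1..Suc i} = (!) e ` {..i}"
  proof -
    have "{1..Suc i} = Suc ` {..i}" by (simp add: image_Suc_atMost)
    then show ?thesis by (simp add: image_image letter_def)
  qed
  then show ?thesis using True by (simp add: dval_def pmax_def letter_def)
next
  case False
  have "pmax e i = e ! i"
  proof (rule pmax_eqI)
    show "e ! j \<le> e ! i" if "j \<le> i" for j
      using that seq021_mono[OF assms(1) that assms(2)] False by (cases "e ! j = 0") auto
  qed auto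
  then show ?thesis using False by (simp add: dval_def letter_def)
qed

lemma covered_Suc_iff:
  assumes "i < length e"
  shows "Suc i \<in> covered e \<longleftrightarrow> cov0 e i"
proof
  assume "Suc i \<in> covered e"
  then obtain a b where *: "1 \<le> a" "a < Suc i" "Suc i < b" "b \<le> length e" "letter e a = letter e b" "letter e a \<noteq> 0" "e ! i = 0"
    by (auto simp: covered_def letter_def)
  then show "cov0 e i" unfolding cov0_def letter_def
    by (intro conjI exI[of _ "a - 1"] exI[of _ "b - 1"]) auto
next
  assume "cov0 e i"
  then obtain a b where *: "e ! i = 0" "a < i" "b < length e" "i < b" "e ! a = e ! b" "e ! a \<noteq> 0"
    unfolding cov0_def by blast
  have "1 \<le> Suc a \<and> Suc a < Suc i \<and> Suc i < Suc b \<and> Suc b \<le> length e \<and>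
      letter e (Suc a) = letter e (Suc b) \<and> letter e (Suc a) \<noteq> 0"
    using * by (simp add: letter_def)
  moreover have "letter e (Suc i) = 0" using * by (simp add: letter_def)
  ultimately show "Suc i \<in> covered e" using assms unfolding covered_def by auto
qed

lemma stats_seq_of_perm_of:
  fixes t :: stree
  defines "e \<equiv> seq_of t" and "p \<equiv> perm_of t"
  shows "DIST e = VID p" "ASC e = DES p" "ZERO e = LMA p" "EMA e = LMI p" "RMI e = RMA p" "EXPO e = RMI p"
proof -
  let ?n = "leaves t"
  have len: "length e = ?n" "length p = ?n" by (simp_all add: e_def p_def length_seq_of length_perm_of)
  note defs = len letter_def ball_before_iff ball_after_iff
  have e: "seq021 e" by (simp add: e_def seq021_seq_of)
  show "ZERO e = LMA p"
  proof (rule position_set_eqI[where n = ?n])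
    show "Suc i \<in> ZERO e \<longleftrightarrow> Suc i \<in> LMA p" if "i < ?n" for i
      using zero_iff_lma[OF that] that unfolding ZERO_def LMA_def mem_Collect_eq defs by (simp add: e_def p_def)
  qed (auto simp: ZERO_def LMA_def len)
  show "EMA e = LMI p"
  proof (rule position_set_eqI[where n = ?n])
    show "Suc i \<in> EMA e \<longleftrightarrow> Suc i \<in> LMI p" if "i < ?n" for i
      using ema_iff_lmi[OF that] that unfolding EMA_def LMI_def mem_Collect_eq defs by (simp add: e_def p_def)
  qed (auto simp: EMA_def LMI_def len)
  show "RMI e = RMA p"
  proof (rule position_set_eqI[where n = ?n])
    show "Suc i \<in> RMI e \<longleftrightarrow> Suc i \<in> RMA p" if "i < ?n" for i
      using rmi_iff_rma[OF that] that unfolding RMI_def RMA_def mem_Collect_eq defs by (simp add: e_def p_def)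
  qed (auto simp: RMI_def RMA_def len)
  show "ASC e = DES p"
  proof (rule position_set_eqI[where n = ?n])
    show "Suc i \<in> ASC e \<longleftrightarrow> Suc i \<in> DES p" if "i < ?n" for i
      using asc_iff_des[of i t] that unfolding ASC_def DES_def mem_Collect_eq defs by (auto simp: e_def p_def)
  qed (auto simp: ASC_def DES_def len)
  show "DIST e = VID p"
  proof (rule position_set_eqI[where n = ?n])
    show "Suc i \<in> DIST e \<longleftrightarrow> Suc i \<in> VID p" if i: "i < ?n" for i
    proof -
      \<comment> \<open>The first position lies on neither side because \<open>e ! 0 = 0\<close>,
        which accounts for \<open>DIST\<close> starting at 2.\<close>
      have "Suc i \<in> DIST e \<longleftrightarrow> e ! i \<noteq> 0 \<and> (\<forall>j<?n. i < j \<longrightarrow> e ! i \<noteq> e ! j)"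
        using i seq021_0[OF e] unfolding DIST_def mem_Collect_eq defs by (cases i) auto
      also have "\<dots> \<longleftrightarrow> (\<exists>j<i. p ! j = p ! i + 1)" using dist_iff_vid[OF i] by (simp add: e_def p_def)
      also have "\<dots> \<longleftrightarrow> p ! i < ?n \<and> (\<exists>j<i. p ! j = p ! i + 1)"
      proof -
        have "p ! i < ?n" if "j < i" "p ! j = p ! i + 1" for j
          using perm_of_range(2)[of j t] that i by (simp add: p_def)
        then show ?thesis by blast
      qed
      also have "\<dots> \<longleftrightarrow> Suc i \<in> VID p"
        using i ball_before_iff[of i "\<lambda>j. p ! (j - 1) \<noteq> p ! i + 1"]
        unfolding VID_def mem_Collect_eq len letter_def by auto
      finally show ?thesis .
    qed
  qed (auto simp: DIST_def VID_def len)
  show "EXPO e = RMI p"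
  proof (rule position_set_eqI[where n = ?n])
    show "Suc i \<in> EXPO e \<longleftrightarrow> Suc i \<in> RMI p" if i: "i < ?n" for i
    proof -
      have "int (Suc i) - int (dval e (Suc i)) < int (Suc j) - int (dval e (Suc j)) \<longleftrightarrow>
          i + pmax e j < j + pmax e i" if "j < ?n" for j
        using dval_seq021[OF e, of i] dval_seq021[OF e, of j] i that len by auto
      then have "Suc i \<in> EXPO e \<longleftrightarrow> expo0 e i"
        using covered_Suc_iff[of i e] i unfolding EXPO_def expo0_def mem_Collect_eq len ball_after_iff by auto
      also have "\<dots> \<longleftrightarrow> (\<forall>j<?n. i < j \<longrightarrow> p ! i < p ! j)" using expo_iff_rmi[OF i] by (simp add: e_def p_def)
      also have "\<dots> \<longleftrightarrow> Suc i \<in> RMI p" using i unfolding RMI_def mem_Collect_eq defs by auto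
      finally show ?thesis .
    qed
  qed (auto simp: EXPO_def RMI_def len)
qed

theorem theorem1p2:
  fixes n :: nat
  assumes "n \<ge> 1"
  shows "\<exists>\<Psi>. bij_betw \<Psi> {e \<in> inv_seqs n. avoids e [0, 2, 1]}
                       {\<pi> \<in> perms n. avoids \<pi> [2, 4, 1, 3] \<and> avoids \<pi> [4, 2, 1, 3]} \<and>
     (\<forall>e \<in> {e \<in> inv_seqs n. avoids e [0, 2, 1]}.
        DIST e = VID (\<Psi> e) \<and> ASC e = DES (\<Psi> e) \<and> ZERO e = LMA (\<Psi> e) \<and>
        EMA e = LMI (\<Psi> e) \<and> RMI e = RMA (\<Psi> e) \<and> EXPO e = RMI (\<Psi> e))"
proof -
  let ?T = "{t. leaves t = n}"
  have "{e \<in> inv_seqs n. avoids e [0, 2, 1]} = seq_of ` ?T"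
  proof (rule set_eqI)
    fix e
    show "e \<in> {e \<in> inv_seqs n. avoids e [0, 2, 1]} \<longleftrightarrow> e \<in> seq_of ` ?T"
      using seq021_iff[OF assms, of e] seq021_seq_of length_seq_of seq_of_surj[of e] by auto
  qed
  moreover have "{\<pi> \<in> perms n. avoids \<pi> [2, 4, 1, 3] \<and> avoids \<pi> [4, 2, 1, 3]} = perm_of ` ?T"
  proof (rule set_eqI)
    fix p
    show "p \<in> {\<pi> \<in> perms n. avoids \<pi> [2, 4, 1, 3] \<and> avoids \<pi> [4, 2, 1, 3]} \<longleftrightarrow> p \<in> perm_of ` ?T"
      using schroeder_perm_iff[OF assms, of p] schroeder_perm_perm_of length_perm_of perm_of_surj[of p] by auto
  qed
  moreover have injs: "inj_on seq_of ?T" "inj_on perm_of ?T"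
    using inj_seq_of inj_perm_of by (auto simp: inj_on_def)
  \<comment> \<open>The bijection reads off the tree of an inversion sequence and writes the
    permutation of this tree.\<close>
  then have "bij_betw (perm_of \<circ> inv_into ?T seq_of) (seq_of ` ?T) (perm_of ` ?T)"
    by (meson bij_betw_imageI bij_betw_inv_into bij_betw_trans)
  moreover have "(perm_of \<circ> inv_into ?T seq_of) (seq_of t) = perm_of t" if "t \<in> ?T" for t
    using inv_into_f_f[OF injs(1) that] by simp
  ultimately show ?thesis
    using stats_seq_of_perm_of by (intro exI[of _ "perm_of \<circ> inv_into ?T seq_of"]) auto
qed

end
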